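(* Let $1\le q\le t$ be integers and let $\ell\in\{0,\ldots,q-1\}$. If $\mathcal{P}_{2q-\ell-1}\subseteq\mathcal{Z}_t$, then the projector $Q_t^q$ defined in the context satisfies $$(Q_t^qu)^{(\ell)}(b)= u^{(\ell)}(b)\quad\text{for all } u\in H^q(a,b).$$
   Context: Let $a<b$ be real. $\partial$ is the (weak) derivative, $H^q(a,b)=\{u\in L^2(a,b):\partial^\alpha u\in L^2(a,b),\ \alpha=1,\ldots,q\}$, $H^0(a,b)=L^2(a,b)$; point values of functions in $H^q(a,b)$ and of their derivatives up to order $q-1$ are those of the continuous representatives. $\mathcal{P}_k$ is the space of polynomials of degree at most $k$ (restricted to $[a,b]$). Define $(Kf)(x)=\int_a^x f(y)\,dy$ and its $L^2$-adjoint $(K^*f)(x)=\int_x^b f(y)\,dy$. Let $\mathcal{Z}_0\supseteq\mathcal{P}_0$ be any finite dimensional subspace of $L^2(a,b)$ and for integers $t\ge 1$ let $\mathcal{Z}_t:=\mathcal{P}_0+K(\mathcal{Z}_{t-1})$, where it is assumed that $\mathcal{P}_0+K(\mathcal{Z}_{t-1})=\mathcal{P}_0+K^*(\mathcal{Z}_{t-1})$ (sums need not be direct). Let $Z_t$ be the $L^2(a,b)$-orthogonal projector onto $\mathcal{Z}_t$. The projectors $Q_t^q:H^q(a,b)\to\mathcal{Z}_t$, $q=0,\ldots,t$, are defined recursively by $Q_t^0:=Z_t$ and, for $q\ge1$, $Q_t^q u:=u(a)+KQ_{t-1}^{q-1}\partial u$. *)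

theory Defs
  imports "HOL-Analysis.Analysis" "HOL-Computational_Algebra.Polynomial"
begin

text \<open>
  Elements of \<open>L\<^sup>2(a,b)\<close> (real scalars) are represented by functions on the reals that matter only
  up to almost-everywhere equality on the open interval. Subspaces of \<open>L\<^sup>2(a,b)\<close> are
  sets of representatives that are closed under almost-everywhere equality.
\<close>

definition L2 :: "real \<Rightarrow> real \<Rightarrow> (real \<Rightarrow> real) set" where
  "L2 a b = {f. f \<in> borel_measurable (lebesgue_on {a<..<b}) \<and>
                integrable (lebesgue_on {a<..<b}) (\<lambda>x. (f x)\<^sup>2)}"

definition ae_eq :: "real \<Rightarrow> real \<Rightarrow> (real \<Rightarrow> real) \<Rightarrow> (real \<Rightarrow> real) \<Rightarrow> bool" where
  "ae_eq a b f g \<longleftrightarrow> (AE x in lebesgue_on {a<..<b}. f x = g x)"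

definition l2_inner :: "real \<Rightarrow> real \<Rightarrow> (real \<Rightarrow> real) \<Rightarrow> (real \<Rightarrow> real) \<Rightarrow> real" where
  "l2_inner a b f g = (\<integral>x. f x * g x \<partial>lebesgue_on {a<..<b})"

definition l2_subspace :: "real \<Rightarrow> real \<Rightarrow> (real \<Rightarrow> real) set \<Rightarrow> bool" where
  "l2_subspace a b V \<longleftrightarrow>
     V \<subseteq> L2 a b \<and>
     (\<forall>f\<in>V. \<forall>g\<in>L2 a b. ae_eq a b f g \<longrightarrow> g \<in> V) \<and>
     (\<lambda>x. 0) \<in> V \<and>
     (\<forall>f\<in>V. \<forall>g\<in>V. (\<lambda>x. f x + g x) \<in> V) \<and>
     (\<forall>c. \<forall>f\<in>V. (\<lambda>x. c * f x) \<in> V)"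

definition l2_finite_dim :: "real \<Rightarrow> real \<Rightarrow> (real \<Rightarrow> real) set \<Rightarrow> bool" where
  "l2_finite_dim a b V \<longleftrightarrow>
     (\<exists>B. finite B \<and> B \<subseteq> V \<and>
          (\<forall>f\<in>V. \<exists>c. ae_eq a b f (\<lambda>x. \<Sum>g\<in>B. c g * g x)))"

definition l2_sum ::
  "real \<Rightarrow> real \<Rightarrow> (real \<Rightarrow> real) set \<Rightarrow> (real \<Rightarrow> real) set \<Rightarrow> (real \<Rightarrow> real) set" where
  "l2_sum a b U V = {f \<in> L2 a b. \<exists>g\<in>U. \<exists>h\<in>V. ae_eq a b f (\<lambda>x. g x + h x)}"

text \<open>The choice is unique up to almost-everywhere equality when \<open>V\<close> is a
  finite-dimensional subspace and \<open>u\<close> is in \<open>L\<^sup>2(a,b)\<close>.\<close>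

definition l2_proj ::
  "real \<Rightarrow> real \<Rightarrow> (real \<Rightarrow> real) set \<Rightarrow> (real \<Rightarrow> real) \<Rightarrow> (real \<Rightarrow> real)" where
  "l2_proj a b V u = (SOME p. p \<in> V \<and> (\<forall>v\<in>V. l2_inner a b (\<lambda>x. u x - p x) v = 0))"

definition polys :: "real \<Rightarrow> real \<Rightarrow> nat \<Rightarrow> (real \<Rightarrow> real) set" where
  "polys a b k = {f \<in> L2 a b. \<exists>p :: real poly. degree p \<le> k \<and> ae_eq a b f (poly p)}"

definition test_fun :: "real \<Rightarrow> real \<Rightarrow> (real \<Rightarrow> real) \<Rightarrow> bool" where
  "test_fun a b \<phi> \<longleftrightarrow>
     (\<forall>n x. (deriv ^^ n) \<phi> field_differentiable (at x)) \<and>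
     compact (closure {x. \<phi> x \<noteq> 0}) \<and> closure {x. \<phi> x \<noteq> 0} \<subseteq> {a<..<b}"

text \<open>\<open>v\<close> is the weak derivative of order \<open>k\<close> of \<open>u\<close>, both in \<open>L\<^sup>2(a,b)\<close>.\<close>

definition has_weak_deriv ::
  "real \<Rightarrow> real \<Rightarrow> nat \<Rightarrow> (real \<Rightarrow> real) \<Rightarrow> (real \<Rightarrow> real) \<Rightarrow> bool" where
  "has_weak_deriv a b k u v \<longleftrightarrow>
     u \<in> L2 a b \<and> v \<in> L2 a b \<and>
     (\<forall>\<phi>. test_fun a b \<phi> \<longrightarrow> l2_inner a b u ((deriv ^^ k) \<phi>) = (-1) ^ k * l2_inner a b v \<phi>)"

definition weak_deriv :: "real \<Rightarrow> real \<Rightarrow> nat \<Rightarrow> (real \<Rightarrow> real) \<Rightarrow> (real \<Rightarrow> real)" where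
  "weak_deriv a b k u = (SOME v. has_weak_deriv a b k u v)"

definition sobolev_H :: "real \<Rightarrow> real \<Rightarrow> nat \<Rightarrow> (real \<Rightarrow> real) set" where
  "sobolev_H a b q = {u \<in> L2 a b. \<forall>k\<in>{1..q}. \<exists>v\<in>L2 a b. has_weak_deriv a b k u v}"

definition cont_rep :: "real \<Rightarrow> real \<Rightarrow> (real \<Rightarrow> real) \<Rightarrow> (real \<Rightarrow> real)" where
  "cont_rep a b u = (SOME v. continuous_on {a..b} v \<and> ae_eq a b u v)"

text \<open>The value at \<open>x \<in> [a,b]\<close> of the weak derivative of order \<open>k\<close> of \<open>u\<close>.\<close>

definition point_val :: "real \<Rightarrow> real \<Rightarrow> nat \<Rightarrow> (real \<Rightarrow> real) \<Rightarrow> real \<Rightarrow> real" where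
  "point_val a b k u x = cont_rep a b (weak_deriv a b k u) x"

definition int_op :: "real \<Rightarrow> (real \<Rightarrow> real) \<Rightarrow> (real \<Rightarrow> real)" where
  "int_op a f = (\<lambda>x. \<integral>y. f y \<partial>lebesgue_on {a<..<x})"

definition int_op_adj :: "real \<Rightarrow> (real \<Rightarrow> real) \<Rightarrow> (real \<Rightarrow> real)" where
  "int_op_adj b f = (\<lambda>x. \<integral>y. f y \<partial>lebesgue_on {x<..<b})"

primrec Zspace ::
  "real \<Rightarrow> real \<Rightarrow> (real \<Rightarrow> real) set \<Rightarrow> nat \<Rightarrow> (real \<Rightarrow> real) set" where
  "Zspace a b Z0 0 = Z0"
| "Zspace a b Z0 (Suc t) = l2_sum a b (polys a b 0) (int_op a ` Zspace a b Z0 t)"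

text \<open>\<open>Qproj a b Z0 q t\<close> is the projector \<open>Q\<^sub>t\<^sup>q\<close>. It is meant for \<open>q \<le> t\<close> only, so that
  the subtraction below never truncates.\<close>

primrec Qproj ::
  "real \<Rightarrow> real \<Rightarrow> (real \<Rightarrow> real) set \<Rightarrow> nat \<Rightarrow> nat \<Rightarrow> (real \<Rightarrow> real) \<Rightarrow> (real \<Rightarrow> real)" where
  "Qproj a b Z0 0 t u = l2_proj a b (Zspace a b Z0 t) u"
| "Qproj a b Z0 (Suc q) t u =
     (\<lambda>x. point_val a b 0 u a + int_op a (Qproj a b Z0 q (t - 1) (weak_deriv a b 1 u)) x)"

end

(*
  Write Q for the projectors and suppress representatives. Each derivative lowers both indices of
  Q by one, so it suffices to treat l = 0, where the claim is that the integral of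
  u' - Q_{t-1}^{q-1} u' over (a,b) vanishes. For m \<le> n, the error v - Q_n^m v is K applied to the
  error one level down, and the adjoint of K raises polynomial degrees by one; unfolding the
  recursion therefore moves the constant 1 to a polynomial of degree m tested against an L2
  projection error, which is zero once P_m lies in the space at level n - m. That inclusion
  follows from the hypothesis by differentiation: P_{k+1} in Z_{t+1} implies P_k in Z_t.
*)

theory Submission
  imports Defs
begin

section \<open>Smooth bump functions\<close>

text \<open>The degree 2q-l-1 is exactly what two descents consume. Passing to the derivative of
  order l costs l levels and l degrees and leaves degree 2r-1 at level t-l, where r = q-l. The
  adjoint argument, applied to the projector with indices r-1 and t-l-1, turns the constant 1 into a
  polynomial of degree at most r-1 tested at level t-q; r further differentiations of the inclusion
  reach degree r-1 at that very level. The bulk of the work lies elsewhere.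
  \<open>weak_deriv\<close> and \<open>cont_rep\<close> are arbitrary choices, so nothing can be
  computed before uniqueness is known: for derivatives this is the fundamental lemma of the calculus
  of variations. The formula u = u(a) + K u', which gives point values a meaning, is the lemma of du
  Bois-Reymond. Both require enough test functions, hence the construction of smooth functions with
  compact support from exp(-1/y). For \<open>l2_proj\<close>, existence and orthogonality
  suffice.\<close>

definition smooth :: "(real \<Rightarrow> real) \<Rightarrow> bool" where
  "smooth f \<longleftrightarrow> (\<forall>n x. (deriv ^^ n) f field_differentiable (at x))"

text \<open>Iterated derivatives rarely have a manageable closed form. A class of differentiable
  functions closed under \<open>deriv\<close> contains all iterates of its members, so only one
  derivative ever has to be computed.\<close>

lemma smooth_coinduct:
  assumes "f \<in> C" "\<And>g x. g \<in> C \<Longrightarrow> g field_differentiable (at x)" "\<And>g. g \<in> C \<Longrightarrow> deriv g \<in> C"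
  shows "smooth f"
proof -
  have "(deriv ^^ n) f \<in> C" for n
    by (induction n) (use assms in auto)
  then show ?thesis
    unfolding smooth_def using assms(2) by blast
qed

lemma smooth_deriv: "smooth f \<Longrightarrow> smooth (deriv f)"
  unfolding smooth_def by (metis comp_apply funpow_Suc_right)

lemma smooth_field_differentiable: "smooth f \<Longrightarrow> f field_differentiable (at x)"
  unfolding smooth_def by (metis funpow_0)

text \<open>Adding \<open>f\<close> to the class of smooth functions keeps that class closed under
  \<open>deriv\<close>.\<close>

lemma smooth_antideriv:
  assumes "\<And>x. (f has_field_derivative g x) (at x)" "smooth g"
  shows "smooth f"
proof (rule smooth_coinduct)
  show "f \<in> {h. h = f \<or> smooth h}" by simp
  have "deriv f = g" using assms(1) DERIV_imp_deriv by blast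
  then show "deriv h \<in> {h. h = f \<or> smooth h}" if "h \<in> {h. h = f \<or> smooth h}" for h
    using that assms(2) smooth_deriv by auto
  show "h field_differentiable (at x)" if "h \<in> {h. h = f \<or> smooth h}" for h x
    using that assms(1)[of x] smooth_field_differentiable field_differentiable_def by blast
qed

lemma smooth_linear_combination:
  assumes "smooth f" "smooth g"
  shows "smooth (\<lambda>x. f x + c * g x)"
proof (rule smooth_coinduct)
  let ?C = "{h. \<exists>f g. smooth f \<and> smooth g \<and> h = (\<lambda>x. f x + c * g x)}"
  have D: "((\<lambda>x. f x + c * g x) has_field_derivative deriv f x + c * deriv g x) (at x)"
    if "smooth f" "smooth g" for f g x
    using that by (intro DERIV_add DERIV_cmult)
      (auto simp: DERIV_deriv_iff_field_differentiable smooth_field_differentiable)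
  show "(\<lambda>x. f x + c * g x) \<in> ?C" using assms by blast
  show "h field_differentiable (at x)" if "h \<in> ?C" for h x
    using that D field_differentiable_def by blast
  show "deriv h \<in> ?C" if "h \<in> ?C" for h
  proof -
    obtain f g where *: "smooth f" "smooth g" "h = (\<lambda>x. f x + c * g x)" using \<open>h \<in> ?C\<close> by blast
    then have "deriv h = (\<lambda>x. deriv f x + c * deriv g x)"
      using D[OF *(1,2)] DERIV_imp_deriv by blast
    then show ?thesis using * smooth_deriv by blast
  qed
qed

text \<open>The parameter \<open>k\<close> makes the functions \<open>poly p x * flat k (poly s x)\<close>, for fixed \<open>s\<close>,
  a family closed under differentiation.\<close>

definition flat :: "nat \<Rightarrow> real \<Rightarrow> real" where
  "flat k y = (if y > 0 then exp (- (1 / y)) / y ^ k else 0)"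

lemma flat_mult: "y ^ i * flat (k + i) y = flat k y"
  by (auto simp: flat_def power_add)

text \<open>On the right, y = 1/z turns the claim into z^k / exp z tending to 0 at infinity; on the
  left the function is constantly 0. This is the limit of the difference quotient in
  \<open>DERIV_flat\<close>.\<close>

lemma flat_tendsto_0: "(flat k \<longlongrightarrow> 0) (at 0)"
proof -
  have "((\<lambda>y::real. y ^ k / exp y) \<longlongrightarrow> 0) at_top" by (rule tendsto_power_div_exp_0)
  then have "((\<lambda>y::real. inverse y ^ k / exp (inverse y)) \<longlongrightarrow> 0) (at_right 0)"
    by (rule filterlim_compose) (rule filterlim_inverse_at_top_right)
  moreover have "eventually (\<lambda>y::real. inverse y ^ k / exp (inverse y) = flat k y) (at_right 0)"
    by (auto simp: eventually_at_right_field flat_def exp_minus field_simps intro: exI[of _ 1])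
  ultimately have R: "(flat k \<longlongrightarrow> 0) (at_right 0)"
    by (rule Lim_transform_eventually)
  have "eventually (\<lambda>y::real. 0 = flat k y) (at_left 0)"
    by (auto simp: eventually_at_left_field flat_def intro: exI[of _ "-1"])
  then have "(flat k \<longlongrightarrow> 0) (at_left 0)"
    using Lim_transform_eventually tendsto_const by fast
  with R show ?thesis by (simp add: filterlim_at_split)
qed

text \<open>The derivative is again a combination of functions \<open>flat\<close>, with larger
  index. Only y = 0 is not a calculation with derivative rules.\<close>

lemma DERIV_flat:
  "(flat k has_field_derivative (flat (k + 2) y - real k * flat (k + 1) y)) (at y)"
proof -
  consider "y > 0" | "y < 0" | "y = 0" by linarith
  then show ?thesis
  proof cases
    case 1
    have "((\<lambda>y. exp (- (1 / y)) / y ^ k) has_field_derivative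
        (exp (- (1/y)) * (1 / y^2) * y^k - exp (- (1/y)) * (real k * y ^ (k - 1))) / (y^k * y^k)) (at y)"
      using 1 by (auto intro!: derivative_eq_intros simp: power2_eq_square)
    moreover have "(exp (- (1/y)) * (1 / y^2) * y^k - exp (- (1/y)) * (real k * y ^ (k - 1))) / (y^k * y^k)
      = flat (k + 2) y - real k * flat (k + 1) y"
      using 1 by (cases k) (auto simp: flat_def power2_eq_square field_simps)
    ultimately have "((\<lambda>y. exp (- (1 / y)) / y ^ k) has_field_derivative
       (flat (k + 2) y - real k * flat (k + 1) y)) (at y)" by simp
    then show ?thesis
      by (rule DERIV_cong_ev[THEN iffD1, rotated -1])
        (use 1 in \<open>auto simp: flat_def eventually_nhds_metric intro!: exI[of _ y]\<close>, auto simp: dist_real_def)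
  next
    case 2
    have "((\<lambda>y. 0) has_field_derivative (flat (k + 2) y - real k * flat (k + 1) y)) (at y)"
      using 2 by (simp add: flat_def)
    then show ?thesis
      by (rule DERIV_cong_ev[THEN iffD1, rotated -1])
        (use 2 in \<open>auto simp: flat_def eventually_nhds_metric intro!: exI[of _ "-y"]\<close>, auto simp: dist_real_def)
  next
    case 3
    \<comment> \<open>Dividing by h raises the index by one. The equality includes h = 0, where
      division by zero yields 0 and \<open>flat\<close> is 0 too.\<close>
    have "(\<lambda>h. (flat k h - flat k 0) / h) = flat (k + 1)"
      by (auto simp: flat_def)
    then show ?thesis
      using flat_tendsto_0[of "k + 1"] 3 by (simp add: DERIV_def flat_def)
  qed
qed

lemma smooth_poly_flat:
  "smooth (\<lambda>x. poly p x * flat k (poly s x))"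
proof (rule smooth_coinduct)
  let ?f = "\<lambda>p k x. poly p x * flat k (poly s x)"
  let ?C = "{f. \<exists>p k. f = ?f p k}"
  \<comment> \<open>Product and chain rule produce \<open>flat\<close> with indices k, k+1 and k+2.
    All are brought to index k+2 by \<open>flat_mult\<close>, at the price of factors s^2, s and 1,
    so one polynomial collects everything.\<close>
  have D: "(?f p k has_field_derivative
      ?f (pderiv p * s\<^sup>2 + p * pderiv s - smult (real k) (p * pderiv s * s)) (k + 2) x) (at x)" for p k x
  proof -
    have "flat k (poly s x) = (poly s x)\<^sup>2 * flat (k + 2) (poly s x)"
      "flat (k + 1) (poly s x) = poly s x * flat (k + 2) (poly s x)"
      using flat_mult[of "poly s x" 2 k] flat_mult[of "poly s x" 1 "k + 1"] by simp_all
    then have E: "poly (pderiv p) x * flat k (poly s x) +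
       (flat (k + 2) (poly s x) - real k * flat (k + 1) (poly s x)) * poly (pderiv s) x * poly p x
      = ?f (pderiv p * s\<^sup>2 + p * pderiv s - smult (real k) (p * pderiv s * s)) (k + 2) x"
      by (simp add: algebra_simps)
    have "((\<lambda>x. flat k (poly s x)) has_field_derivative
        (flat (k + 2) (poly s x) - real k * flat (k + 1) (poly s x)) * poly (pderiv s) x) (at x)"
      by (rule DERIV_chain2[OF DERIV_flat poly_DERIV])
    from DERIV_mult[OF poly_DERIV[of p] this] show ?thesis unfolding E .
  qed
  show "?f p k \<in> ?C" by blast
  show "h field_differentiable (at x)" if "h \<in> ?C" for h x
    using that D field_differentiable_def by blast
  show "deriv h \<in> ?C" if "h \<in> ?C" for h
  proof -
    obtain p k where h: "h = ?f p k" using \<open>h \<in> ?C\<close> by blast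
    have "deriv h = ?f (pderiv p * s\<^sup>2 + p * pderiv s - smult (real k) (p * pderiv s * s)) (k + 2)"
      unfolding h using D[of p k] DERIV_imp_deriv by blast
    then show ?thesis by blast
  qed
qed

section \<open>The integration operator\<close>

lemma finite_measure_lebesgue_on_interval: "finite_measure (lebesgue_on {a<..<b::real})"
  by (intro finite_measure_lebesgue_on lmeasurable_interval bounded_set_imp_lmeasurable) auto

lemma integrable_lebesgue_on_subinterval:
  fixes f :: "real \<Rightarrow> real"
  assumes "integrable (lebesgue_on {a<..<b}) f" "a \<le> c" "d \<le> b"
  shows "integrable (lebesgue_on {c<..<d}) f"
proof -
  have "set_integrable lebesgue {a<..<b} f"
    using assms(1) by (simp add: integrable_restrict_space set_integrable_def)
  then have "set_integrable lebesgue {c<..<d} f"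
    by (rule set_integrable_subset) (use assms in auto)
  then show ?thesis
    by (simp add: integrable_restrict_space set_integrable_def)
qed

text \<open>Moves variable limits into the integrand, so that all integrals live on one measure
  space, as Fubini and almost-everywhere arguments require.\<close>

lemma integral_lebesgue_on_subinterval:
  fixes f :: "real \<Rightarrow> real"
  assumes "a \<le> c" "d \<le> b"
  shows "integral\<^sup>L (lebesgue_on {c<..<d}) f =
    (\<integral>x. (if c < x \<and> x < d then f x else 0) \<partial>lebesgue_on {a<..<b})"
  using assms by (auto simp: integral_restrict_space intro!: Bochner_Integration.integral_cong
      split: split_indicator)

text \<open>The bridge to the gauge integral, for which the fundamental theorem of calculus is
  stated.\<close>

lemma integral_lebesgue_on_interval_eq:
  fixes f :: "real \<Rightarrow> real"
  assumes "integrable (lebesgue_on {c<..<d}) f"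
  shows "integral\<^sup>L (lebesgue_on {c<..<d}) f = integral {c..d} f"
  using lebesgue_integral_eq_integral[OF assms] by (simp add: integral_open_interval_real)

lemma int_op_eq_integral:
  assumes "integrable (lebesgue_on {a<..<b}) f" "x \<le> b"
  shows "int_op a f x = integral {a..x} f"
  unfolding int_op_def
  by (intro integral_lebesgue_on_interval_eq integrable_lebesgue_on_subinterval[OF assms(1)])
    (use assms in auto)

lemma int_op_left [simp]: "int_op a f a = 0"
  by (simp add: int_op_def integral_empty space_restrict_space)

lemma continuous_on_int_op:
  assumes "integrable (lebesgue_on {a<..<b}) f"
  shows "continuous_on {a..b} (int_op a f)"
proof -
  have "f integrable_on {a<..<b}"
    using assms integrable_on_lebesgue_on by fastforce
  then have "f integrable_on {a..b}"
    by (simp add: integrable_on_open_interval_real)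
  from indefinite_integral_continuous_1[OF this] show ?thesis
    by (rule continuous_on_cong[THEN iffD1, rotated -1]) (auto simp: int_op_eq_integral[OF assms])
qed

lemma borel_measurable_lebesgue_on_continuous:
  fixes g :: "real \<Rightarrow> real"
  assumes "continuous_on {a..b} g"
  shows "g \<in> borel_measurable (lebesgue_on {a<..<b})"
  by (rule continuous_imp_measurable_on_sets_lebesgue)
    (auto intro: continuous_on_subset[OF assms])

lemma continuous_bounded_interval:
  fixes g :: "real \<Rightarrow> real"
  assumes "continuous_on {a..b} g"
  obtains C where "C \<ge> 0" "\<And>x. x \<in> {a..b} \<Longrightarrow> \<bar>g x\<bar> \<le> C"
proof -
  have "bounded (g ` {a..b})"
    by (intro compact_imp_bounded compact_continuous_image assms) auto
  then obtain C where "\<And>x. x \<in> {a..b} \<Longrightarrow> \<bar>g x\<bar> \<le> C"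
    unfolding bounded_iff by (metis imageI real_norm_def)
  then show ?thesis using that[of "max 0 C"] by fastforce
qed

lemma integrable_mult_continuous:
  fixes f g :: "real \<Rightarrow> real"
  assumes "integrable (lebesgue_on {a<..<b}) f" "continuous_on {a..b} g"
  shows "integrable (lebesgue_on {a<..<b}) (\<lambda>x. f x * g x)"
proof -
  obtain C where C: "C \<ge> 0" "\<And>x. x \<in> {a..b} \<Longrightarrow> \<bar>g x\<bar> \<le> C"
    using continuous_bounded_interval[OF assms(2)] by blast
  have [measurable]: "g \<in> borel_measurable (lebesgue_on {a<..<b})"
    by (rule borel_measurable_lebesgue_on_continuous[OF assms(2)])
  have [measurable]: "f \<in> borel_measurable (lebesgue_on {a<..<b})"
    using assms(1) by auto
  show ?thesis
  proof (rule Bochner_Integration.integrable_bound)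
    show "integrable (lebesgue_on {a<..<b}) (\<lambda>x. C * f x)" using assms(1) by simp
    show "AE x in lebesgue_on {a<..<b}. norm (f x * g x) \<le> norm (C * f x)"
    proof (rule AE_I2)
      fix x assume "x \<in> space (lebesgue_on {a<..<b})"
      then have "\<bar>g x\<bar> \<le> C" by (intro C) (simp add: space_restrict_space)
      then have "\<bar>f x\<bar> * \<bar>g x\<bar> \<le> \<bar>f x\<bar> * C" by (rule mult_left_mono) simp
      then show "norm (f x * g x) \<le> norm (C * f x)" using C(1) by (simp add: abs_mult mult.commute)
    qed
  qed measurable
qed

lemma integrable_const_interval: "integrable (lebesgue_on {a<..<b::real}) (\<lambda>x. c::real)"
  using finite_measure_lebesgue_on_interval by (rule finite_measure.integrable_const)

lemma integrable_lebesgue_on_continuous: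
  fixes g :: "real \<Rightarrow> real"
  shows "continuous_on {a..b} g \<Longrightarrow> integrable (lebesgue_on {a<..<b}) g"
  using integrable_mult_continuous[OF integrable_const_interval[of a b 1]] by simp

text \<open>Since \<open>G b = 0\<close>, the function -G is the adjoint of K applied to
  \<open>g\<close>, so this is the adjoint relation in the form in which polynomial degrees can be
  read off. As \<open>e\<close> is merely integrable, the proof is Fubini on a triangle and not a
  product rule.\<close>

lemma integral_by_parts_int_op:
  fixes e G g :: "real \<Rightarrow> real"
  assumes e: "integrable (lebesgue_on {a<..<b}) e" and g: "continuous_on {a..b} g"
    and G: "\<And>x. x \<in> {a..b} \<Longrightarrow> (G has_field_derivative g x) (at x within {a..b})" and "G b = 0"
  shows "(\<integral>x. int_op a e x * g x \<partial>lebesgue_on {a<..<b}) = - (\<integral>x. e x * G x \<partial>lebesgue_on {a<..<b})"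
proof -
  let ?M = "lebesgue_on {a<..<b}"
  interpret M: finite_measure ?M by (rule finite_measure_lebesgue_on_interval)
  interpret P: pair_sigma_finite ?M ?M ..
  have gi: "integrable ?M g" by (rule integrable_lebesgue_on_continuous[OF g])
  have [measurable]: "g \<in> borel_measurable ?M" "e \<in> borel_measurable ?M"
    using e gi by auto
  \<comment> \<open>Integrating over y < x first gives K e times g; integrating over x > y first
    gives e times the integral of g from y to b, that is -e G.\<close>
  define F where "F = (\<lambda>y x. if y < x then e y * g x else 0)"
  have [measurable]: "(\<lambda>x. x) \<in> borel_measurable ?M"
    by (intro borel_measurable_lebesgue_on_continuous continuous_intros)
  \<comment> \<open>The triangle function is dominated by the full product of \<open>e\<close> and
    \<open>g\<close>, which is integrable on the square.\<close>
  have "integrable (?M \<Otimes>\<^sub>M ?M) (case_prod F)"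
  proof (rule Bochner_Integration.integrable_bound)
    show "integrable (?M \<Otimes>\<^sub>M ?M) (\<lambda>(y, x). e y * g x)"
    proof (rule P.Fubini_integrable)
      show "integrable ?M (\<lambda>x. LINT y|?M. norm (case (x, y) of (y, x) \<Rightarrow> e y * g x))"
        using e by (simp add: abs_mult)
      show "AE x in ?M. integrable ?M (\<lambda>y. case (x, y) of (y, x) \<Rightarrow> e y * g x)"
        using gi by simp
    qed measurable
    show "case_prod F \<in> borel_measurable (?M \<Otimes>\<^sub>M ?M)" unfolding F_def by measurable
    show "AE x in ?M \<Otimes>\<^sub>M ?M. norm (case x of (y, x) \<Rightarrow> F y x) \<le> norm (case x of (y, x) \<Rightarrow> e y * g x)"
      by (auto simp: F_def)
  qed
  from P.Fubini_integral[OF this]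
  have Fubini: "(\<integral>x. (\<integral>y. F y x \<partial>?M) \<partial>?M) = (\<integral>y. (\<integral>x. F y x \<partial>?M) \<partial>?M)" .
  have left: "(\<integral>y. F y x \<partial>?M) = int_op a e x * g x" if "x \<in> {a<..<b}" for x
  proof -
    have "int_op a e x = (\<integral>y. (if a < y \<and> y < x then e y else 0) \<partial>?M)"
      unfolding int_op_def by (rule integral_lebesgue_on_subinterval) (use that in auto)
    then have "int_op a e x * g x = (\<integral>y. (if a < y \<and> y < x then e y else 0) * g x \<partial>?M)"
      by simp
    also have "\<dots> = (\<integral>y. F y x \<partial>?M)"
      by (rule Bochner_Integration.integral_cong) (auto simp: F_def space_restrict_space)
    finally show ?thesis ..
  qed
  have right: "(\<integral>x. F y x \<partial>?M) = - (e y * G y)" if y: "y \<in> {a<..<b}" for y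
  proof -
    have "(g has_integral (G b - G y)) {y..b}"
      by (rule fundamental_theorem_of_calculus)
        (use y in \<open>auto intro!: DERIV_subset[OF G] simp flip: has_real_derivative_iff_has_vector_derivative\<close>)
    then have "- G y = integral {y..b} g" using \<open>G b = 0\<close> by (simp add: integral_unique)
    also have "\<dots> = integral\<^sup>L (lebesgue_on {y<..<b}) g"
      by (rule integral_lebesgue_on_interval_eq[symmetric], rule integrable_lebesgue_on_subinterval[OF gi])
        (use y in auto)
    also have "\<dots> = (\<integral>x. (if y < x \<and> x < b then g x else 0) \<partial>?M)"
      by (rule integral_lebesgue_on_subinterval) (use y in auto)
    finally have "e y * - G y = (\<integral>x. e y * (if y < x \<and> x < b then g x else 0) \<partial>?M)"
      by simp
    then have "- (e y * G y) = (\<integral>x. e y * (if y < x \<and> x < b then g x else 0) \<partial>?M)"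
      by simp
    also have "\<dots> = (\<integral>x. F y x \<partial>?M)"
      by (rule Bochner_Integration.integral_cong) (auto simp: F_def space_restrict_space)
    finally show ?thesis ..
  qed
  have "(\<integral>x. int_op a e x * g x \<partial>?M) = (\<integral>x. (\<integral>y. F y x \<partial>?M) \<partial>?M)"
    by (rule Bochner_Integration.integral_cong) (auto simp: left space_restrict_space)
  also have "\<dots> = (\<integral>y. - (e y * G y) \<partial>?M)"
    unfolding Fubini by (rule Bochner_Integration.integral_cong) (auto simp: right space_restrict_space)
  finally show ?thesis by simp
qed

section \<open>The Hilbert space of square integrable functions\<close>

lemma L2_I:
  assumes "f \<in> borel_measurable (lebesgue_on {a<..<b})"
    "integrable (lebesgue_on {a<..<b}) (\<lambda>x. f x * f x)"
  shows "f \<in> L2 a b"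
  using assms by (simp add: L2_def power2_eq_square)

lemma L2_measurable [measurable_dest]: "f \<in> L2 a b \<Longrightarrow> f \<in> borel_measurable (lebesgue_on {a<..<b})"
  by (simp add: L2_def)

lemma L2_integrable_mult:
  assumes "f \<in> L2 a b" "g \<in> L2 a b"
  shows "integrable (lebesgue_on {a<..<b}) (\<lambda>x. f x * g x)"
proof (rule Bochner_Integration.integrable_bound)
  show "integrable (lebesgue_on {a<..<b}) (\<lambda>x. (f x)\<^sup>2 + (g x)\<^sup>2)"
    using assms by (simp add: L2_def)
  have "\<bar>x * y\<bar> \<le> \<bar>x\<^sup>2 + y\<^sup>2\<bar>" for x y :: real
  proof -
    have "2 * (\<bar>x\<bar> * \<bar>y\<bar>) \<le> x\<^sup>2 + y\<^sup>2"
      using sum_squares_bound[of "\<bar>x\<bar>" "\<bar>y\<bar>"] by simp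
    moreover have "0 \<le> \<bar>x\<bar> * \<bar>y\<bar>" by simp
    ultimately have "\<bar>x\<bar> * \<bar>y\<bar> \<le> x\<^sup>2 + y\<^sup>2" by linarith
    then show ?thesis by (simp add: abs_mult)
  qed
  then show "AE x in lebesgue_on {a<..<b}. norm (f x * g x) \<le> norm ((f x)\<^sup>2 + (g x)\<^sup>2)" by simp
  show "(\<lambda>x. f x * g x) \<in> borel_measurable (lebesgue_on {a<..<b})"
    using assms by (auto dest!: L2_measurable)
qed

lemma L2_continuous:
  assumes "continuous_on {a..b} g"
  shows "g \<in> L2 a b"
  by (intro L2_I borel_measurable_lebesgue_on_continuous integrable_lebesgue_on_continuous
      continuous_intros assms)

lemma L2_poly: "poly p \<in> L2 a b"
  by (intro L2_continuous continuous_intros)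

lemma L2_const [simp]: "(\<lambda>x. c) \<in> L2 a b"
  by (intro L2_continuous continuous_intros)

lemma L2_integrable: "f \<in> L2 a b \<Longrightarrow> integrable (lebesgue_on {a<..<b}) f"
  using L2_integrable_mult[of f a b "\<lambda>x. 1"] by simp

lemma L2_int_op: "f \<in> L2 a b \<Longrightarrow> int_op a f \<in> L2 a b"
  by (rule L2_continuous[OF continuous_on_int_op[OF L2_integrable]])

lemma L2_add:
  assumes "f \<in> L2 a b" "g \<in> L2 a b" shows "(\<lambda>x. f x + g x) \<in> L2 a b"
proof (rule L2_I)
  show "(\<lambda>x. f x + g x) \<in> borel_measurable (lebesgue_on {a<..<b})"
    using assms by (auto dest!: L2_measurable)
  have "integrable (lebesgue_on {a<..<b}) (\<lambda>x. f x * f x + f x * g x + (g x * f x + g x * g x))"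
    by (intro Bochner_Integration.integrable_add L2_integrable_mult assms)
  then show "integrable (lebesgue_on {a<..<b}) (\<lambda>x. (f x + g x) * (f x + g x))"
    by (simp add: algebra_simps)
qed

lemma L2_cmult:
  assumes "f \<in> L2 a b" shows "(\<lambda>x. c * f x) \<in> L2 a b"
proof (rule L2_I)
  show "(\<lambda>x. c * f x) \<in> borel_measurable (lebesgue_on {a<..<b})"
    using assms by (auto dest!: L2_measurable)
  have "integrable (lebesgue_on {a<..<b}) (\<lambda>x. c * c * (f x * f x))"
    by (intro integrable_mult_right L2_integrable_mult assms)
  then show "integrable (lebesgue_on {a<..<b}) (\<lambda>x. c * f x * (c * f x))"
    by (simp add: mult_ac)
qed

lemma L2_diff: "f \<in> L2 a b \<Longrightarrow> g \<in> L2 a b \<Longrightarrow> (\<lambda>x. f x - g x) \<in> L2 a b"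
  using L2_add[OF _ L2_cmult, of f a b g "-1"] by simp

lemma L2_sum: "(\<And>i. i \<in> I \<Longrightarrow> f i \<in> L2 a b) \<Longrightarrow> (\<lambda>x. \<Sum>i\<in>I. f i x) \<in> L2 a b"
  by (induction I rule: infinite_finite_induct) (auto intro: L2_add)

lemma l2_inner_add_left:
  "f \<in> L2 a b \<Longrightarrow> g \<in> L2 a b \<Longrightarrow> h \<in> L2 a b \<Longrightarrow>
    l2_inner a b (\<lambda>x. f x + g x) h = l2_inner a b f h + l2_inner a b g h"
  by (simp add: l2_inner_def distrib_right L2_integrable_mult)

lemma l2_inner_diff_left:
  "f \<in> L2 a b \<Longrightarrow> g \<in> L2 a b \<Longrightarrow> h \<in> L2 a b \<Longrightarrow>
    l2_inner a b (\<lambda>x. f x - g x) h = l2_inner a b f h - l2_inner a b g h"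
  by (simp add: l2_inner_def left_diff_distrib L2_integrable_mult)

lemma l2_inner_cmult_left: "l2_inner a b (\<lambda>x. c * f x) h = c * l2_inner a b f h"
  by (simp add: l2_inner_def mult.assoc)

lemma l2_inner_commute: "l2_inner a b f g = l2_inner a b g f"
  by (simp add: l2_inner_def mult.commute)

lemma l2_inner_sum_right:
  assumes "f \<in> L2 a b" "\<And>i. i \<in> I \<Longrightarrow> g i \<in> L2 a b"
  shows "l2_inner a b f (\<lambda>x. \<Sum>i\<in>I. c i * g i x) = (\<Sum>i\<in>I. c i * l2_inner a b f (g i))"
proof -
  have "(\<lambda>x. f x * (c i * g i x)) = (\<lambda>x. c i * (f x * g i x))" for i
    by auto
  then show ?thesis
    using assms by (simp add: l2_inner_def sum_distrib_left L2_integrable_mult)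
qed

lemma ae_eq_refl [simp]: "ae_eq a b f f"
  by (simp add: ae_eq_def)

lemma ae_eq_sym: "ae_eq a b f g \<Longrightarrow> ae_eq a b g f"
  unfolding ae_eq_def by (auto elim: eventually_mono)

lemma ae_eq_trans: "ae_eq a b f g \<Longrightarrow> ae_eq a b g h \<Longrightarrow> ae_eq a b f h"
  unfolding ae_eq_def by (auto elim: eventually_elim2)

lemma ae_eq_I: "(\<And>x. a < x \<Longrightarrow> x < b \<Longrightarrow> f x = g x) \<Longrightarrow> ae_eq a b f g"
  unfolding ae_eq_def by (intro AE_I2) (auto simp: space_restrict_space)

lemma ae_eq_add: "ae_eq a b f g \<Longrightarrow> ae_eq a b f' g' \<Longrightarrow> ae_eq a b (\<lambda>x. f x + f' x) (\<lambda>x. g x + g' x)"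
  unfolding ae_eq_def by (auto elim: eventually_elim2)

lemma ae_eq_diff: "ae_eq a b f g \<Longrightarrow> ae_eq a b f' g' \<Longrightarrow> ae_eq a b (\<lambda>x. f x - f' x) (\<lambda>x. g x - g' x)"
  unfolding ae_eq_def by (auto elim: eventually_elim2)

lemma ae_eq_cmult: "ae_eq a b f g \<Longrightarrow> ae_eq a b (\<lambda>x. c * f x) (\<lambda>x. c * g x)"
  unfolding ae_eq_def by (auto elim: eventually_mono)

lemma l2_inner_cong:
  assumes "f \<in> L2 a b" "f' \<in> L2 a b" "g \<in> L2 a b" "g' \<in> L2 a b" "ae_eq a b f f'" "ae_eq a b g g'"
  shows "l2_inner a b f g = l2_inner a b f' g'"
  unfolding l2_inner_def
proof (rule integral_cong_AE)
  show "AE x in lebesgue_on {a<..<b}. f x * g x = f' x * g' x"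
    using assms(5,6) unfolding ae_eq_def by eventually_elim simp
qed (use assms in \<open>auto dest!: L2_measurable\<close>)

lemma l2_inner_eq_0_imp_ae_eq_0:
  assumes "f \<in> L2 a b" "l2_inner a b f f = 0"
  shows "ae_eq a b f (\<lambda>x. 0)"
proof -
  have "AE x in lebesgue_on {a<..<b}. f x * f x = 0"
    using assms by (subst (asm) l2_inner_def, subst (asm) integral_nonneg_eq_0_iff_AE)
      (auto intro: L2_integrable_mult)
  then show ?thesis unfolding ae_eq_def by simp
qed

text \<open>K does not see the representative, and the two results agree at every point rather than
  almost everywhere. Beyond \<open>b\<close> the functions are unrelated, hence the bound on
  \<open>x\<close>.\<close>

lemma int_op_cong:
  assumes "f \<in> L2 a b" "g \<in> L2 a b" "ae_eq a b f g" "x \<le> b"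
  shows "int_op a f x = int_op a g x"
proof -
  have "f \<in> borel_measurable (lebesgue_on {a<..<b})" "g \<in> borel_measurable (lebesgue_on {a<..<b})"
    using assms by (auto dest!: L2_measurable)
  then have m: "(\<lambda>y. if a < y \<and> y < x then f y else 0) \<in> borel_measurable (lebesgue_on {a<..<b})"
    "(\<lambda>y. if a < y \<and> y < x then g y else 0) \<in> borel_measurable (lebesgue_on {a<..<b})"
    using borel_measurable_lebesgue_on_continuous[of a b "\<lambda>x. x"] by (auto intro!: measurable_If)
  show ?thesis
    unfolding int_op_def integral_lebesgue_on_subinterval[OF order.refl \<open>x \<le> b\<close>]
  proof (rule integral_cong_AE[OF m])
    show "AE y in lebesgue_on {a<..<b}. (if a < y \<and> y < x then f y else 0) = (if a < y \<and> y < x then g y else 0)"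
      using assms(3) unfolding ae_eq_def by eventually_elim simp
  qed
qed

lemma ae_eq_int_op:
  "f \<in> L2 a b \<Longrightarrow> g \<in> L2 a b \<Longrightarrow> ae_eq a b f g \<Longrightarrow> ae_eq a b (int_op a f) (int_op a g)"
  by (rule ae_eq_I, rule int_op_cong) auto

lemma int_op_add:
  assumes "f \<in> L2 a b" "g \<in> L2 a b" "x \<le> b"
  shows "int_op a (\<lambda>x. f x + g x) x = int_op a f x + int_op a g x"
  unfolding int_op_def
  using integrable_lebesgue_on_subinterval[OF L2_integrable[OF assms(1)] order.refl assms(3)]
    integrable_lebesgue_on_subinterval[OF L2_integrable[OF assms(2)] order.refl assms(3)]
  by (rule Bochner_Integration.integral_add)

lemma int_op_cmult: "int_op a (\<lambda>x. c * f x) x = c * int_op a f x"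
  by (simp add: int_op_def)

lemma int_op_diff:
  assumes "f \<in> L2 a b" "g \<in> L2 a b" "x \<le> b"
  shows "int_op a (\<lambda>x. f x - g x) x = int_op a f x - int_op a g x"
  using int_op_add[OF assms(1) L2_cmult[OF assms(2), of "-1"] assms(3)] int_op_cmult[of a "-1" g]
  by simp

lemma int_op_sum:
  assumes "\<And>i. i \<in> I \<Longrightarrow> g i \<in> L2 a b" "x \<le> b"
  shows "int_op a (\<lambda>x. \<Sum>i\<in>I. c i * g i x) x = (\<Sum>i\<in>I. c i * int_op a (g i) x)"
  using assms(1)
proof (induction I rule: infinite_finite_induct)
  case (insert i I)
  have "int_op a (\<lambda>x. c i * g i x + (\<Sum>i\<in>I. c i * g i x)) x
      = int_op a (\<lambda>x. c i * g i x) x + int_op a (\<lambda>x. \<Sum>i\<in>I. c i * g i x) x"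
    by (intro int_op_add[OF _ _ \<open>x \<le> b\<close>] L2_sum L2_cmult) (use insert in auto)
  then show ?case using insert by (simp add: int_op_cmult)
qed (auto simp: int_op_def)

section \<open>Test functions and their supports\<close>

lemma test_fun_iff_smooth:
  "test_fun a b \<phi> \<longleftrightarrow> smooth \<phi> \<and> compact (closure {x. \<phi> x \<noteq> 0}) \<and> closure {x. \<phi> x \<noteq> 0} \<subseteq> {a<..<b}"
  by (simp add: test_fun_def smooth_def)

lemma test_fun_I:
  assumes "smooth \<phi>" "a < c" "d < b" "\<And>x. x < c \<or> x > d \<Longrightarrow> \<phi> x = 0"
  shows "test_fun a b \<phi>"
proof -
  have "{x. \<phi> x \<noteq> 0} \<subseteq> {c..d}" using assms(4) by (metis (mono_tags) atLeastAtMost_iff mem_Collect_eq not_le subsetI)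
  then have "closure {x. \<phi> x \<noteq> 0} \<subseteq> {c..d}" by (rule closure_minimal) simp
  moreover from this have "compact (closure {x. \<phi> x \<noteq> 0})"
    by (auto simp: compact_eq_bounded_closed intro: bounded_subset[OF bounded_closed_interval])
  moreover have "{c..d} \<subseteq> {a<..<b}" using assms(2,3) by auto
  ultimately show ?thesis using assms(1) unfolding test_fun_iff_smooth by simp
qed

lemma test_fun_support:
  assumes "test_fun a b \<phi>" "a < b"
  obtains c d where "a < c" "c < d" "d < b" "\<forall>x. x < c \<or> x > d \<longrightarrow> \<phi> x = 0"
proof -
  \<comment> \<open>The midpoint is added so that the compact set is nonempty even for \<phi> = 0
    and its least and greatest elements exist.\<close>
  let ?S = "insert ((a + b) / 2) (closure {x. \<phi> x \<noteq> 0})"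
  have S: "compact ?S" "?S \<subseteq> {a<..<b}" "?S \<noteq> {}"
    using assms by (auto simp: test_fun_def)
  obtain s where s: "s \<in> ?S" "\<And>x. x \<in> ?S \<Longrightarrow> s \<le> x"
    using compact_attains_inf[OF S(1,3)] by blast
  obtain t where t: "t \<in> ?S" "\<And>x. x \<in> ?S \<Longrightarrow> x \<le> t"
    using compact_attains_sup[OF S(1,3)] by blast
  have z: "x \<in> ?S" if "\<phi> x \<noteq> 0" for x
    using that closure_subset[of "{x. \<phi> x \<noteq> 0}"] by auto
  show ?thesis
  \<comment> \<open>Moving halfway towards the end points makes c < d strict even when s =
    t.\<close>
  proof (rule that[of "(a + s) / 2" "(t + b) / 2"])
    have "a < s" "t < b" using s(1) t(1) S(2) by (meson greaterThanLessThan_iff subsetD)+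
    moreover have "s \<le> t" using s(2) t(1) by blast
    ultimately show "a < (a + s) / 2" "(a + s) / 2 < (t + b) / 2" "(t + b) / 2 < b" by (simp_all add: field_simps)
    show "\<forall>x. x < (a + s) / 2 \<or> x > (t + b) / 2 \<longrightarrow> \<phi> x = 0"
    proof (intro allI impI)
      fix x assume "x < (a + s) / 2 \<or> x > (t + b) / 2"
      then have "x < s \<or> x > t" using \<open>a < s\<close> \<open>t < b\<close> by (auto simp: field_simps)
      then have "x \<notin> ?S" using s(2) t(2) by (meson not_le)
      then show "\<phi> x = 0" using z by blast
    qed
  qed
qed

lemma test_fun_continuous: "test_fun a b \<phi> \<Longrightarrow> continuous_on S \<phi>"
  unfolding test_fun_iff_smooth
  by (rule continuous_at_imp_continuous_on)
    (simp add: field_differentiable_imp_continuous_at smooth_field_differentiable)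

lemma L2_test_fun: "test_fun a b \<phi> \<Longrightarrow> \<phi> \<in> L2 a b"
  by (intro L2_continuous test_fun_continuous)

text \<open>Off its closed support \<phi> vanishes on a neighbourhood, so its derivative vanishes
  there and the support cannot grow.\<close>

lemma test_fun_deriv:
  assumes "test_fun a b \<phi>"
  shows "test_fun a b (deriv \<phi>)"
proof -
  have *: "\<phi> x = 0" if "x \<notin> closure {x. \<phi> x \<noteq> 0}" for x
    using that closure_subset[of "{x. \<phi> x \<noteq> 0}"] by auto
  have "deriv \<phi> x = 0" if "x \<notin> closure {x. \<phi> x \<noteq> 0}" for x
  proof -
    have "eventually (\<lambda>y. y \<notin> closure {x. \<phi> x \<noteq> 0}) (nhds x)"
      using that eventually_nhds_in_open[of "- closure {x. \<phi> x \<noteq> 0}" x] by (simp add: open_Compl)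
    then have "eventually (\<lambda>y. \<phi> y = 0) (nhds x)"
      by eventually_elim (rule *)
    then have "deriv \<phi> x = deriv (\<lambda>x. 0) x" by (rule deriv_cong_ev) simp
    then show ?thesis by simp
  qed
  then have "{x. deriv \<phi> x \<noteq> 0} \<subseteq> closure {x. \<phi> x \<noteq> 0}" by blast
  then have "closure {x. deriv \<phi> x \<noteq> 0} \<subseteq> closure {x. \<phi> x \<noteq> 0}"
    by (simp add: closure_minimal)
  then show ?thesis
    using assms smooth_deriv[of \<phi>] bounded_subset[OF _ \<open>closure _ \<subseteq> closure _\<close>]
      order_trans[OF \<open>closure _ \<subseteq> closure _\<close>]
    unfolding test_fun_iff_smooth compact_eq_bounded_closed by simp
qed

lemma test_fun_deriv_funpow: "test_fun a b \<phi> \<Longrightarrow> test_fun a b ((deriv ^^ k) \<phi>)"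
  by (induction k) (auto intro: test_fun_deriv)

section \<open>The fundamental lemma of the calculus of variations\<close>

text \<open>With the bound by 1 that follows, this makes \<open>flat 0\<close> composed with a large
  quadratic a cutoff function fit for dominated convergence.\<close>

lemma flat_0_tendsto_1: "(flat 0 \<longlongrightarrow> 1) at_top"
proof -
  have "((\<lambda>y::real. exp (- (1 / y))) \<longlongrightarrow> exp (- 0)) at_top"
    using tendsto_inverse_0_at_top[OF filterlim_ident]
    by (intro tendsto_exp tendsto_minus) (simp add: inverse_eq_divide)
  moreover have "eventually (\<lambda>y. exp (- (1 / y)) = flat 0 y) at_top"
    using eventually_gt_at_top[of 0] by eventually_elim (simp add: flat_def)
  ultimately show ?thesis
    using Lim_transform_eventually by fastforce
qed

lemma abs_flat_0_le_1: "\<bar>flat 0 y\<bar> \<le> 1"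
  by (simp add: flat_def)

text \<open>The class of functions orthogonal to \<open>v\<close> is enlarged in stages: from test
  functions to polynomials here, then to continuous functions, then to a bounded function with the
  sign of \<open>v\<close>. In this stage p is a pointwise limit of test functions p times cutoff,
  dominated by |p|.\<close>

lemma integral_mult_poly_eq_0:
  assumes "a < b" and v: "integrable (lebesgue_on {a<..<b}) v"
    and test: "\<And>\<phi>. test_fun a b \<phi> \<Longrightarrow> (\<integral>x. v x * \<phi> x \<partial>lebesgue_on {a<..<b}) = 0"
  shows "(\<integral>x. v x * poly p x \<partial>lebesgue_on {a<..<b}) = 0"
proof -
  let ?M = "lebesgue_on {a<..<b}"
  \<comment> \<open>The 3 ensures that \<epsilon> is at most a third of the length, so the shrunken
    interval is nonempty for every n.\<close>
  define \<epsilon> where "\<epsilon> n = (b - a) / (real n + 3)" for n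
  \<comment> \<open>A parabola that is positive exactly between a + \<epsilon> and b - \<epsilon>,
    so the cutoff vanishes outside. The factor n+1 sends its value at each interior point to
    infinity, where \<open>flat 0\<close> tends to 1.\<close>
  define s where "s n = smult (real (Suc n)) ([:- a - \<epsilon> n, 1:] * [:b - \<epsilon> n, - 1:])" for n
  define \<phi> where "\<phi> n x = poly p x * flat 0 (poly (s n) x)" for n x
  have s: "poly (s n) x = real (Suc n) * ((x - a - \<epsilon> n) * (b - \<epsilon> n - x))" for n x
    by (simp add: s_def algebra_simps)
  have \<epsilon>: "\<epsilon> n > 0" "a + \<epsilon> n < b - \<epsilon> n" for n
  proof -
    show "\<epsilon> n > 0" using \<open>a < b\<close> by (simp add: \<epsilon>_def)
    have "\<epsilon> n \<le> (b - a) / 3" using \<open>a < b\<close> unfolding \<epsilon>_def by (intro divide_left_mono) auto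
    then show "a + \<epsilon> n < b - \<epsilon> n" using \<open>a < b\<close> by (simp add: field_simps)
  qed
  have tf: "test_fun a b (\<phi> n)" for n
  proof (rule test_fun_I)
    show "smooth (\<phi> n)" unfolding \<phi>_def by (rule smooth_poly_flat)
    show "a < a + \<epsilon> n" "b - \<epsilon> n < b" using \<epsilon> by auto
    fix x assume "x < a + \<epsilon> n \<or> x > b - \<epsilon> n"
    then have "(x - a - \<epsilon> n) * (b - \<epsilon> n - x) \<le> 0"
      using \<epsilon>(2)[of n] by (auto simp: mult_le_0_iff)
    then have "poly (s n) x \<le> 0" unfolding s by (simp add: mult_le_0_iff)
    then show "\<phi> n x = 0" by (simp add: \<phi>_def flat_def)
  qed
  have \<epsilon>0: "\<epsilon> \<longlonglongrightarrow> 0" unfolding \<epsilon>_def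
    by (rule real_tendsto_divide_at_top[OF tendsto_const], subst add.commute)
      (rule filterlim_tendsto_add_at_top[OF tendsto_const filterlim_real_sequentially])
  have lim: "(\<lambda>n. \<phi> n x) \<longlonglongrightarrow> poly p x" if x: "x \<in> {a<..<b}" for x
  proof -
    have "(\<lambda>n. (x - a - \<epsilon> n) * (b - \<epsilon> n - x)) \<longlonglongrightarrow> (x - a - 0) * (b - 0 - x)"
      by (intro tendsto_intros \<epsilon>0)
    moreover have "(x - a - 0) * (b - 0 - x) > 0" using x by simp
    moreover have "filterlim (\<lambda>n. real (Suc n)) at_top sequentially"
      by (rule filterlim_compose[OF filterlim_real_sequentially filterlim_Suc])
    ultimately have "filterlim (\<lambda>n. poly (s n) x) at_top sequentially"
      unfolding s by (subst mult.commute) (rule filterlim_tendsto_pos_mult_at_top)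
    then have "(\<lambda>n. flat 0 (poly (s n) x)) \<longlonglongrightarrow> 1"
      by (rule filterlim_compose[OF flat_0_tendsto_1])
    then have "(\<lambda>n. poly p x * flat 0 (poly (s n) x)) \<longlonglongrightarrow> poly p x * 1"
      by (rule tendsto_mult_left)
    then show ?thesis by (simp add: \<phi>_def)
  qed
  have vp: "integrable ?M (\<lambda>x. v x * poly p x)"
    by (intro integrable_mult_continuous v continuous_intros)
  have "(\<lambda>n. \<integral>x. v x * \<phi> n x \<partial>?M) \<longlonglongrightarrow> (\<integral>x. v x * poly p x \<partial>?M)"
  proof (rule integral_dominated_convergence)
    show "integrable ?M (\<lambda>x. \<bar>v x * poly p x\<bar>)" using vp by simp
    show "(\<lambda>x. v x * poly p x) \<in> borel_measurable ?M" using vp by auto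
    show "(\<lambda>x. v x * \<phi> n x) \<in> borel_measurable ?M" for n
      using integrable_mult_continuous[OF v test_fun_continuous[OF tf]] by auto
    show "AE x in ?M. (\<lambda>n. v x * \<phi> n x) \<longlonglongrightarrow> v x * poly p x"
      by (rule AE_I2) (auto intro!: tendsto_mult_left lim simp: space_restrict_space)
    show "AE x in ?M. norm (v x * \<phi> n x) \<le> \<bar>v x * poly p x\<bar>" for n
    proof (rule AE_I2)
      fix x
      have "\<bar>v x * poly p x\<bar> * \<bar>flat 0 (poly (s n) x)\<bar> \<le> \<bar>v x * poly p x\<bar> * 1"
        by (rule mult_left_mono[OF abs_flat_0_le_1]) simp
      then show "norm (v x * \<phi> n x) \<le> \<bar>v x * poly p x\<bar>"
        by (simp add: \<phi>_def abs_mult)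
    qed
  qed
  then show ?thesis using test[OF tf] by (simp add: LIMSEQ_const_iff)
qed

lemma real_polynomial_function_is_poly:
  fixes f :: "real \<Rightarrow> real"
  assumes "real_polynomial_function f"
  obtains p where "f = poly p"
proof -
  obtain c n where "f = (\<lambda>x. \<Sum>i\<le>n. c i * x ^ i)"
    using assms real_polynomial_function_iff_sum by blast
  then have "f = poly (\<Sum>i\<le>n. monom (c i) i)"
    by (auto simp: poly_sum poly_monom)
  then show ?thesis by (rule that)
qed

text \<open>By Stone-Weierstrass, g is within e of a polynomial uniformly; the error in the integral
  is at most e times the integral of |v|, for every e > 0.\<close>

lemma integral_mult_continuous_eq_0:
  fixes v g :: "real \<Rightarrow> real"
  assumes v: "integrable (lebesgue_on {a<..<b}) v" and g: "continuous_on {a..b} g"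
    and polys: "\<And>p. (\<integral>x. v x * poly p x \<partial>lebesgue_on {a<..<b}) = 0"
  shows "(\<integral>x. v x * g x \<partial>lebesgue_on {a<..<b}) = 0"
proof -
  let ?M = "lebesgue_on {a<..<b}"
  let ?I = "\<integral>x. \<bar>v x\<bar> \<partial>?M"
  have vg: "integrable ?M (\<lambda>x. v x * g x)" by (rule integrable_mult_continuous[OF v g])
  have bound: "\<bar>\<integral>x. v x * g x \<partial>?M\<bar> \<le> e * ?I" if "e > 0" for e
  proof -
    obtain f where f: "real_polynomial_function f" "\<And>x. x \<in> {a..b} \<Longrightarrow> \<bar>g x - f x\<bar> < e"
      using Stone_Weierstrass_real_polynomial_function[OF _ g \<open>e > 0\<close>] by auto
    obtain p where p: "f = poly p" by (rule real_polynomial_function_is_poly[OF f(1)])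
    have vp: "integrable ?M (\<lambda>x. v x * poly p x)"
      by (intro integrable_mult_continuous v continuous_intros)
    have "(\<integral>x. v x * g x \<partial>?M) = (\<integral>x. v x * g x - v x * poly p x \<partial>?M)"
      using vg vp polys[of p] by simp
    also have "\<bar>\<dots>\<bar> \<le> (\<integral>x. \<bar>v x * g x - v x * poly p x\<bar> \<partial>?M)"
      by (rule integral_abs_bound)
    also have "\<dots> \<le> (\<integral>x. e * \<bar>v x\<bar> \<partial>?M)"
    proof (rule Bochner_Integration.integral_mono)
      fix x assume "x \<in> space ?M"
      then have "\<bar>g x - poly p x\<bar> \<le> e" using f(2)[of x] p by (simp add: space_restrict_space)
      then have "\<bar>v x\<bar> * \<bar>g x - poly p x\<bar> \<le> \<bar>v x\<bar> * e" by (rule mult_left_mono) simp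
      then show "\<bar>v x * g x - v x * poly p x\<bar> \<le> e * \<bar>v x\<bar>"
        by (metis abs_mult mult.commute right_diff_distrib)
    qed (use v vg vp in auto)
    finally show ?thesis by simp
  qed
  have "\<bar>\<integral>x. v x * g x \<partial>?M\<bar> \<le> 0"
  proof (rule tendsto_lowerbound)
    show "((\<lambda>e. e * ?I) \<longlongrightarrow> 0) (at_right 0)" by (auto intro!: tendsto_eq_intros)
    show "eventually (\<lambda>e. \<bar>\<integral>x. v x * g x \<partial>?M\<bar> \<le> e * ?I) (at_right 0)"
      using bound by (auto simp: eventually_at_right_field intro: exI[of _ 1])
  qed simp
  then show ?thesis by simp
qed

text \<open>The ideal test function is v / (1 + |v|): bounded, of the same sign as \<open>v\<close>,
  and its product with \<open>v\<close> is nonnegative and vanishes only where \<open>v\<close>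
  does.\<close>

lemma AE_eq_0_if_orthogonal_continuous:
  fixes v :: "real \<Rightarrow> real"
  assumes v: "integrable (lebesgue_on {a<..<b}) v"
    and cont: "\<And>g. continuous_on {a..b} g \<Longrightarrow> (\<integral>x. v x * g x \<partial>lebesgue_on {a<..<b}) = 0"
  shows "AE x in lebesgue_on {a<..<b}. v x = 0"
proof -
  let ?M = "lebesgue_on {a<..<b}"
  have "v measurable_on {a<..<b}"
    by (rule measurable_on_iff_borel_measurable[THEN iffD2, OF _ borel_measurable_integrable[OF v]]) simp
  then obtain N g where N: "negligible N" and g: "\<And>n. continuous_on UNIV (g n)"
    and lim: "\<And>x. x \<notin> N \<Longrightarrow> (\<lambda>n. g n x) \<longlonglongrightarrow> (if x \<in> {a<..<b} then v x else 0)"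
    unfolding measurable_on_def by blast
  \<comment> \<open>\<open>v\<close> is almost everywhere a limit of continuous g_n. The map y / (1
    + |y|) keeps continuity and forces the bound 1, so |v| dominates v h_n.\<close>
  define h where "h n x = g n x / (1 + \<bar>g n x\<bar>)" for n x
  have h: "continuous_on S (h n)" for n S
    unfolding h_def using continuous_on_subset[OF g[of n], of S]
    by (intro continuous_intros) auto
  have h1: "\<bar>h n x\<bar> \<le> 1" for n x
    by (auto simp: h_def field_simps abs_add_one_gt_zero less_imp_le)
  have w: "(\<lambda>x. v x / (1 + \<bar>v x\<bar>)) \<in> borel_measurable ?M"
    using v by auto
  have "AE x in ?M. x \<notin> N"
  proof -
    have "AE x in lebesgue. x \<notin> N"
      using N by (simp add: negligible_iff_null_sets AE_not_in)
    then show ?thesis by (subst AE_restrict_space_iff) auto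
  qed
  moreover have "AE x in ?M. x \<in> {a<..<b}" by (rule AE_I2) (simp add: space_restrict_space)
  ultimately have L: "AE x in ?M. (\<lambda>n. v x * h n x) \<longlonglongrightarrow> v x * (v x / (1 + \<bar>v x\<bar>))"
  proof eventually_elim
    case (elim x)
    then have "(\<lambda>n. g n x) \<longlonglongrightarrow> v x" using lim[of x] by simp
    then show ?case unfolding h_def by (intro tendsto_intros) auto
  qed
  have "(\<lambda>n. \<integral>x. v x * h n x \<partial>?M) \<longlonglongrightarrow> (\<integral>x. v x * (v x / (1 + \<bar>v x\<bar>)) \<partial>?M)"
  proof (rule integral_dominated_convergence[OF _ _ _ L])
    show "integrable ?M (\<lambda>x. \<bar>v x\<bar>)" using v by simp
    show "(\<lambda>x. v x * (v x / (1 + \<bar>v x\<bar>))) \<in> borel_measurable ?M" using v by auto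
    show "(\<lambda>x. v x * h n x) \<in> borel_measurable ?M" for n
      using integrable_mult_continuous[OF v h] by auto
    show "AE x in ?M. norm (v x * h n x) \<le> \<bar>v x\<bar>" for n
      using mult_left_mono[OF h1, of "\<bar>v _\<bar>"] by (intro AE_I2) (simp add: abs_mult)
  qed
  then have "(\<integral>x. v x * (v x / (1 + \<bar>v x\<bar>)) \<partial>?M) = 0"
    using cont[OF h] by (simp add: LIMSEQ_const_iff)
  moreover have "integrable ?M (\<lambda>x. v x * (v x / (1 + \<bar>v x\<bar>)))"
  proof (rule Bochner_Integration.integrable_bound[OF v])
    show "(\<lambda>x. v x * (v x / (1 + \<bar>v x\<bar>))) \<in> borel_measurable ?M" using v by auto
    have "\<bar>y * (y / (1 + \<bar>y\<bar>))\<bar> \<le> \<bar>y\<bar>" for y :: real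
    proof -
      have "\<bar>y / (1 + \<bar>y\<bar>)\<bar> \<le> 1" by (auto simp: field_simps abs_add_one_gt_zero less_imp_le)
      then have "\<bar>y\<bar> * \<bar>y / (1 + \<bar>y\<bar>)\<bar> \<le> \<bar>y\<bar> * 1" by (rule mult_left_mono) simp
      then show ?thesis by (simp add: abs_mult)
    qed
    then show "AE x in ?M. norm (v x * (v x / (1 + \<bar>v x\<bar>))) \<le> norm (v x)" by simp
  qed
  moreover have "0 \<le> v x * (v x / (1 + \<bar>v x\<bar>))" for x
    by (simp add: zero_le_mult_iff zero_le_divide_iff)
  ultimately have "AE x in ?M. v x * (v x / (1 + \<bar>v x\<bar>)) = 0"
    by (subst (asm) integral_nonneg_eq_0_iff_AE) auto
  then show ?thesis
    by eventually_elim (auto simp: add_nonneg_eq_0_iff)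
qed

lemma fundamental_lemma:
  assumes "a < b" "v \<in> L2 a b" "\<And>\<phi>. test_fun a b \<phi> \<Longrightarrow> l2_inner a b v \<phi> = 0"
  shows "ae_eq a b v (\<lambda>x. 0)"
  unfolding ae_eq_def
proof (rule AE_eq_0_if_orthogonal_continuous)
  show v: "integrable (lebesgue_on {a<..<b}) v" by (rule L2_integrable[OF assms(2)])
  show "(\<integral>x. v x * g x \<partial>lebesgue_on {a<..<b}) = 0" if "continuous_on {a..b} g" for g
    using integral_mult_continuous_eq_0[OF v that] integral_mult_poly_eq_0[OF assms(1) v] assms(3)
    unfolding l2_inner_def by blast
qed

section \<open>Weak derivatives and continuous representatives\<close>

lemma test_fun_has_deriv: "test_fun a b \<phi> \<Longrightarrow> (\<phi> has_field_derivative deriv \<phi> x) (at x)"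
  by (simp add: test_fun_iff_smooth DERIV_deriv_iff_field_differentiable smooth_field_differentiable)

lemma test_fun_eq_0: "test_fun a b \<phi> \<Longrightarrow> x \<notin> {a<..<b} \<Longrightarrow> \<phi> x = 0"
  using closure_subset[of "{x. \<phi> x \<noteq> 0}"] by (auto simp: test_fun_def)

lemma integral_deriv_test_fun:
  assumes "test_fun a b \<phi>"
  shows "(\<integral>x. deriv \<phi> x \<partial>lebesgue_on {a<..<b}) = 0"
proof (cases "a \<le> b")
  case True
  have "(deriv \<phi> has_integral (\<phi> b - \<phi> a)) {a..b}"
    by (rule fundamental_theorem_of_calculus[OF True])
      (simp add: DERIV_subset[OF test_fun_has_deriv[OF assms]]
        flip: has_real_derivative_iff_has_vector_derivative)
  moreover have "\<phi> a = 0" "\<phi> b = 0" by (simp_all add: test_fun_eq_0[OF assms])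
  ultimately show ?thesis
    by (simp add: integral_unique integral_lebesgue_on_interval_eq L2_integrable
        L2_test_fun test_fun_deriv assms)
qed (simp add: integral_empty space_restrict_space)

text \<open>Integration by parts with G = \<phi> and g = \<phi>': \<phi> vanishes at b and K f at a,
  and the constant is annihilated because \<phi>' has mean zero.\<close>

lemma l2_inner_int_op_deriv_test_fun:
  assumes "f \<in> L2 a b" "test_fun a b \<phi>"
  shows "l2_inner a b (\<lambda>x. c + int_op a f x) (deriv \<phi>) = - l2_inner a b f \<phi>"
proof -
  have "l2_inner a b (\<lambda>x. c) (deriv \<phi>) = 0"
    by (simp add: l2_inner_def integral_deriv_test_fun assms(2))
  moreover have "l2_inner a b (int_op a f) (deriv \<phi>) = - l2_inner a b f \<phi>"
    unfolding l2_inner_def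
    by (rule integral_by_parts_int_op)
      (auto intro: L2_integrable assms(1) test_fun_continuous test_fun_deriv assms(2)
        DERIV_subset[OF test_fun_has_deriv[OF assms(2)]] simp: test_fun_eq_0[OF assms(2)])
  ultimately show ?thesis
    by (simp add: l2_inner_add_left L2_int_op L2_test_fun test_fun_deriv assms)
qed

lemma has_weak_deriv_int_op:
  assumes "f \<in> L2 a b"
  shows "has_weak_deriv a b 1 (\<lambda>x. c + int_op a f x) f"
  using assms by (simp add: has_weak_deriv_def l2_inner_int_op_deriv_test_fun L2_add L2_int_op)

text \<open>Makes the choice in \<open>weak_deriv\<close> harmless: any known weak derivative agrees
  with the chosen one almost everywhere.\<close>

lemma has_weak_deriv_unique:
  assumes "a < b" "has_weak_deriv a b k u v" "has_weak_deriv a b k u w"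
  shows "ae_eq a b v w"
proof -
  have vw: "v \<in> L2 a b" "w \<in> L2 a b" using assms by (auto simp: has_weak_deriv_def)
  have "ae_eq a b (\<lambda>x. v x - w x) (\<lambda>x. 0)"
  proof (rule fundamental_lemma[OF \<open>a < b\<close> L2_diff[OF vw]])
    fix \<phi> assume "test_fun a b \<phi>"
    with assms(2,3) have "(-1) ^ k * l2_inner a b v \<phi> = (-1) ^ k * l2_inner a b w \<phi>"
      unfolding has_weak_deriv_def by metis
    then show "l2_inner a b (\<lambda>x. v x - w x) \<phi> = 0"
      using \<open>test_fun a b \<phi>\<close> by (simp add: l2_inner_diff_left vw L2_test_fun)
  qed
  then show ?thesis unfolding ae_eq_def by simp
qed

lemma has_weak_deriv_cong:
  assumes "has_weak_deriv a b k u v" "u' \<in> L2 a b" "v' \<in> L2 a b" "ae_eq a b u u'" "ae_eq a b v v'"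
  shows "has_weak_deriv a b k u' v'"
  unfolding has_weak_deriv_def
proof (intro conjI allI impI assms)
  fix \<phi> assume \<phi>: "test_fun a b \<phi>"
  have uv: "u \<in> L2 a b" "v \<in> L2 a b" using assms by (auto simp: has_weak_deriv_def)
  have "l2_inner a b u' ((deriv ^^ k) \<phi>) = l2_inner a b u ((deriv ^^ k) \<phi>)"
    "l2_inner a b v' \<phi> = l2_inner a b v \<phi>"
    using \<phi> by (intro l2_inner_cong uv assms ae_eq_sym[OF assms(4)] ae_eq_sym[OF assms(5)] ae_eq_refl
       L2_test_fun test_fun_deriv_funpow; simp)+
  then show "l2_inner a b u' ((deriv ^^ k) \<phi>) = (-1) ^ k * l2_inner a b v' \<phi>"
    using assms(1) \<phi> by (simp add: has_weak_deriv_def)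
qed

lemma has_weak_deriv_0: "u \<in> L2 a b \<Longrightarrow> has_weak_deriv a b 0 u u"
  by (simp add: has_weak_deriv_def)

lemma has_weak_deriv_Suc:
  assumes "has_weak_deriv a b 1 u v" "has_weak_deriv a b k v w"
  shows "has_weak_deriv a b (Suc k) u w"
  using assms by (auto simp: has_weak_deriv_def test_fun_deriv_funpow)

text \<open>Both relations are tested with the same \<phi>: the first one, at the derivative of
  order k of \<phi>, trades u for v, and the signs cancel.\<close>

lemma has_weak_deriv_Suc_D:
  assumes "has_weak_deriv a b 1 u v" "has_weak_deriv a b (Suc k) u w"
  shows "has_weak_deriv a b k v w"
  using assms by (auto simp: has_weak_deriv_def test_fun_deriv_funpow)

lemma has_weak_deriv_weak_deriv:
  "has_weak_deriv a b k u v \<Longrightarrow> has_weak_deriv a b k u (weak_deriv a b k u)"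
  unfolding weak_deriv_def by (rule someI[of "has_weak_deriv a b k u"])

lemma ae_eq_weak_deriv:
  "a < b \<Longrightarrow> has_weak_deriv a b k u v \<Longrightarrow> ae_eq a b (weak_deriv a b k u) v"
  by (rule has_weak_deriv_unique[OF _ has_weak_deriv_weak_deriv])

text \<open>No explicit bump is evaluated: if all integrals vanished, the fundamental lemma would
  give 1 = 0 almost everywhere.\<close>

lemma test_fun_with_integral_neq_0:
  assumes "a < b"
  obtains \<psi> where "test_fun a b \<psi>" "(\<integral>x. \<psi> x \<partial>lebesgue_on {a<..<b}) \<noteq> 0"
proof -
  have False if *: "\<And>\<psi>. test_fun a b \<psi> \<Longrightarrow> (\<integral>x. \<psi> x \<partial>lebesgue_on {a<..<b}) = 0"
  proof -
    have "ae_eq a b (\<lambda>x. 1) (\<lambda>x. 0)"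
      by (rule fundamental_lemma) (use * assms in \<open>auto simp: l2_inner_def\<close>)
    then have "l2_inner a b (\<lambda>x. 1) (\<lambda>x. 1) = l2_inner a b (\<lambda>x. 0) (\<lambda>x. 1)"
      by (intro l2_inner_cong) auto
    then show False using assms by (simp add: l2_inner_def space_restrict_space measure_restrict_space)
  qed
  then show ?thesis using that by blast
qed

text \<open>The integral from a vanishes to the left of the support of \<eta>; mean zero is what
  makes it vanish to the right as well.\<close>

lemma test_fun_antideriv:
  assumes "a < b" "test_fun a b \<eta>" "(\<integral>x. \<eta> x \<partial>lebesgue_on {a<..<b}) = 0"
  obtains \<theta> where "test_fun a b \<theta>" "deriv \<theta> = \<eta>"
proof -
  obtain c d where cd: "a < c" "c < d" "d < b" "\<forall>x. x < c \<or> x > d \<longrightarrow> \<eta> x = 0"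
    using test_fun_support[OF assms(2,1)] by blast
  define F where "F x = integral {a..x} \<eta>" for x
  have I: "\<eta> integrable_on S" if "S = {s..t}" for S s t
    unfolding that by (rule integrable_continuous_real) (rule test_fun_continuous[OF assms(2)])
  have "integral {a..b} \<eta> = 0"
    using assms(2,3) by (simp add: integral_lebesgue_on_interval_eq L2_integrable L2_test_fun)
  have F0: "F x = 0" if "a \<le> x" "x \<le> b" "x \<le> c \<or> x \<ge> d" for x
    using that(3)
  proof
    assume "x \<le> c"
    have "(\<eta> has_integral 0) {a..x}"
      by (rule has_integral_spike_finite[of "{x}" _ _ "\<lambda>x. 0"]) (use \<open>x \<le> c\<close> cd in auto)
    then show ?thesis unfolding F_def by (rule integral_unique)
  next
    assume "d \<le> x"
    have "(\<eta> has_integral 0) {x..b}"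
      by (rule has_integral_spike_finite[of "{x}" _ _ "\<lambda>x. 0"]) (use \<open>d \<le> x\<close> cd in auto)
    then have "integral {x..b} \<eta> = 0" by (rule integral_unique)
    then show ?thesis
      using Henstock_Kurzweil_Integration.integral_combine[OF that(1,2) I[OF refl]] \<open>integral {a..b} \<eta> = 0\<close>
      by (simp add: F_def)
  qed
  \<comment> \<open>\<open>F0\<close> controls F on [a,b] only, so the values outside are set to 0;
    near each point \<theta> then coincides with F or with 0.\<close>
  define \<theta> where "\<theta> x = (if a < x \<and> x < b then F x else 0)" for x
  have \<theta>0: "\<theta> x = 0" if "x < c \<or> x > d" for x
    using that F0[of x] by (auto simp: \<theta>_def)
  have D: "(\<theta> has_field_derivative \<eta> x) (at x)" for x
  proof (cases "x \<in> {a<..<b}")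
    case True
    have "(F has_vector_derivative \<eta> x) (at x within {a..b})"
      unfolding F_def
      by (rule integral_has_vector_derivative[OF test_fun_continuous[OF assms(2)]]) (use True in auto)
    then have "(F has_field_derivative \<eta> x) (at x)"
      using True by (simp add: has_real_derivative_iff_has_vector_derivative at_within_Icc_at)
    moreover have "eventually (\<lambda>y. y \<in> {a<..<b}) (nhds x)"
      using True by (intro eventually_nhds_in_open) auto
    then have "eventually (\<lambda>y. \<theta> y = F y) (nhds x)"
      by eventually_elim (simp add: \<theta>_def)
    ultimately show ?thesis
      using DERIV_cong_ev[OF refl _ refl] by blast
  next
    case False
    then have x: "x \<in> {..<c} \<union> {d<..}" using cd by auto
    have "eventually (\<lambda>y. y \<in> {..<c} \<union> {d<..}) (nhds x)"
      by (rule eventually_nhds_in_open) (use x in auto)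
    then have "eventually (\<lambda>y. \<theta> y = 0) (nhds x)"
      by eventually_elim (use \<theta>0 in auto)
    moreover have "\<eta> x = 0" using cd x by auto
    ultimately show ?thesis
      using DERIV_cong_ev[of x x \<theta> "\<lambda>_. 0" 0 0] by simp
  qed
  show ?thesis
  proof (rule that)
    have "smooth \<eta>" using assms(2) by (simp add: test_fun_iff_smooth)
    then show "test_fun a b \<theta>"
      by (intro test_fun_I[of \<theta> a c d b] smooth_antideriv[OF D] \<theta>0 cd)
    show "deriv \<theta> = \<eta>" using D DERIV_imp_deriv by blast
  qed
qed

lemma test_fun_linear_combination:
  assumes "test_fun a b \<phi>" "test_fun a b \<psi>" "a < b"
  shows "test_fun a b (\<lambda>x. \<phi> x + c * \<psi> x)"
proof -
  obtain s t where st: "a < s" "s < t" "t < b" "\<forall>x. x < s \<or> x > t \<longrightarrow> \<phi> x = 0"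
    using test_fun_support[OF assms(1,3)] by blast
  obtain s' t' where st': "a < s'" "s' < t'" "t' < b" "\<forall>x. x < s' \<or> x > t' \<longrightarrow> \<psi> x = 0"
    using test_fun_support[OF assms(2,3)] by blast
  show ?thesis
  proof (rule test_fun_I[of _ a "min s s'" "max t t'"])
    show "smooth (\<lambda>x. \<phi> x + c * \<psi> x)"
      using assms by (intro smooth_linear_combination) (auto simp: test_fun_iff_smooth)
  qed (use st st' in auto)
qed

text \<open>Subtracting a multiple of a fixed \<psi> from \<phi> removes its mean and makes it a
  derivative of a test function, to which w is orthogonal. Hence the pairing of w with \<phi>
  depends only on the mean of \<phi>.\<close>

lemma du_Bois_Reymond:
  assumes "a < b" "w \<in> L2 a b" "\<And>\<phi>. test_fun a b \<phi> \<Longrightarrow> l2_inner a b w (deriv \<phi>) = 0"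
  obtains c where "ae_eq a b w (\<lambda>x. c)"
proof -
  let ?I = "\<lambda>\<phi>. \<integral>x. \<phi> x \<partial>lebesgue_on {a<..<b}"
  obtain \<psi> where \<psi>: "test_fun a b \<psi>" "?I \<psi> \<noteq> 0"
    by (rule test_fun_with_integral_neq_0[OF \<open>a < b\<close>])
  \<comment> \<open>The value forced by testing w = c against \<psi>.\<close>
  define c where "c = l2_inner a b w \<psi> / ?I \<psi>"
  have "ae_eq a b (\<lambda>x. w x - c) (\<lambda>x. 0)"
  proof (rule fundamental_lemma[OF \<open>a < b\<close> L2_diff[OF assms(2) L2_const]])
    fix \<phi> assume \<phi>: "test_fun a b \<phi>"
    define r where "r = ?I \<phi> / ?I \<psi>"
    have "test_fun a b (\<lambda>x. \<phi> x + (- r) * \<psi> x)"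
      by (rule test_fun_linear_combination[OF \<phi> \<psi>(1) \<open>a < b\<close>])
    moreover have "?I (\<lambda>x. \<phi> x + (- r) * \<psi> x) = 0"
      using \<psi>(2) by (simp add: L2_integrable L2_test_fun \<phi> \<psi>(1) r_def)
    ultimately obtain \<theta> where "test_fun a b \<theta>" "deriv \<theta> = (\<lambda>x. \<phi> x + (- r) * \<psi> x)"
      using test_fun_antideriv[OF \<open>a < b\<close>] by metis
    then have "l2_inner a b w (\<lambda>x. \<phi> x + (- r) * \<psi> x) = 0"
      using assms(3) by metis
    then have "l2_inner a b (\<lambda>x. \<phi> x + (- r) * \<psi> x) w = 0"
      by (simp only: l2_inner_commute)
    then have "l2_inner a b w \<phi> = r * l2_inner a b w \<psi>"
      unfolding l2_inner_add_left[OF L2_test_fun[OF \<phi>] L2_cmult[OF L2_test_fun[OF \<psi>(1)]] assms(2)]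
        l2_inner_cmult_left by (simp add: l2_inner_commute)
    moreover have "l2_inner a b (\<lambda>x. c) \<phi> = c * ?I \<phi>" by (simp add: l2_inner_def)
    ultimately show "l2_inner a b (\<lambda>x. w x - c) \<phi> = 0"
      using \<psi>(2) by (simp add: l2_inner_diff_left assms(2) L2_test_fun \<phi> r_def c_def)
  qed
  then have "ae_eq a b w (\<lambda>x. c)" unfolding ae_eq_def by simp
  then show ?thesis by (rule that)
qed

text \<open>u - K v has weak derivative zero, so it is constant. The right-hand side is the
  continuous representative behind all point values.\<close>

lemma weakly_differentiable_eq_int_op:
  assumes "a < b" "has_weak_deriv a b 1 u v"
  obtains c where "ae_eq a b u (\<lambda>x. c + int_op a v x)"
proof -
  have uv: "u \<in> L2 a b" "v \<in> L2 a b" using assms(2) by (auto simp: has_weak_deriv_def)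
  obtain c where "ae_eq a b (\<lambda>x. u x - int_op a v x) (\<lambda>x. c)"
  proof (rule du_Bois_Reymond[OF \<open>a < b\<close> L2_diff[OF uv(1) L2_int_op[OF uv(2)]]])
    fix \<phi> assume \<phi>: "test_fun a b \<phi>"
    then have "l2_inner a b u (deriv \<phi>) = - l2_inner a b v \<phi>"
      using assms(2) by (simp add: has_weak_deriv_def)
    then show "l2_inner a b (\<lambda>x. u x - int_op a v x) (deriv \<phi>) = 0"
      using l2_inner_int_op_deriv_test_fun[OF uv(2) \<phi>, of 0]
      by (simp add: l2_inner_diff_left uv L2_int_op L2_test_fun test_fun_deriv \<phi>)
  qed
  then have "ae_eq a b u (\<lambda>x. c + int_op a v x)"
    unfolding ae_eq_def by (auto elim: eventually_mono)
  then show ?thesis by (rule that)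
qed

text \<open>Inside (a,b) the set where f and g differ is open and negligible, hence empty.
  Continuity then carries equality to the end points, which are the points of interest.\<close>

lemma continuous_ae_eq_imp_eq:
  assumes "a < b" "continuous_on {a..b} f" "continuous_on {a..b} g" "ae_eq a b f g" "x \<in> {a..b}"
  shows "f x = g x"
proof -
  let ?d = "\<lambda>x. f x - g x"
  have d: "continuous_on {a..b} ?d" using assms by (intro continuous_intros)
  let ?U = "{a<..<b} \<inter> ?d -` (- {0})"
  have "open ?U"
    by (rule continuous_open_preimage) (auto intro: continuous_on_subset[OF d])
  moreover have "negligible ?U"
  proof -
    have "AE x in lebesgue. x \<in> {a<..<b} \<longrightarrow> f x = g x"
      using assms(4) unfolding ae_eq_def by (subst (asm) AE_restrict_space_iff) auto
    then obtain N where "N \<in> null_sets lebesgue" "{x. \<not> (x \<in> {a<..<b} \<longrightarrow> f x = g x)} \<subseteq> N"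
      unfolding eventually_ae_filter by auto
    moreover from this have "?U \<subseteq> N" by auto
    ultimately show ?thesis using negligible_iff_null_sets negligible_subset by blast
  qed
  ultimately have "?U = {}" using open_not_negligible by blast
  then have "?d x = 0" if "x \<in> {a<..<b}" for x using that by auto
  then have "?d x = 0"
    by (rule continuous_constant_on_closure[of "{a<..<b}" ?d 0 x, rotated]) (use assms d in auto)
  then show ?thesis by simp
qed

lemma cont_rep_eq:
  assumes "a < b" "continuous_on {a..b} v" "ae_eq a b u v" "x \<in> {a..b}"
  shows "cont_rep a b u x = v x"
proof -
  have "continuous_on {a..b} (cont_rep a b u) \<and> ae_eq a b u (cont_rep a b u)"
    unfolding cont_rep_def by (rule someI[of _ v]) (use assms in simp)
  then show ?thesis
    using assms by (intro continuous_ae_eq_imp_eq) (auto intro: ae_eq_trans ae_eq_sym)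
qed

text \<open>The predicates under the choice operator are equivalent, so the chosen functions are
  identical and not merely equal almost everywhere.\<close>

lemma cont_rep_cong:
  assumes "ae_eq a b u v" shows "cont_rep a b u = cont_rep a b v"
proof -
  have "ae_eq a b u w \<longleftrightarrow> ae_eq a b v w" for w
    using assms ae_eq_sym ae_eq_trans by blast
  then show ?thesis by (simp add: cont_rep_def)
qed

section \<open>Projections and the recursively defined spaces\<close>

lemma l2_inner_zero_right_ae:
  assumes "f \<in> L2 a b" "g \<in> L2 a b" "ae_eq a b g (\<lambda>x. 0)"
  shows "l2_inner a b f g = 0"
proof -
  have "l2_inner a b f g = l2_inner a b f (\<lambda>x. 0)"
    by (intro l2_inner_cong assms ae_eq_refl L2_const)
  then show ?thesis by (simp add: l2_inner_def)
qed

text \<open>One Gram-Schmidt step: with r the residual of u and e the residual of the new vector g,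
  both orthogonal to B, the projection of r onto e is subtracted. The induction varies
  \<open>u\<close> because its hypothesis is applied to both u and g.\<close>

lemma exists_orthogonal_projection:
  assumes "finite B" "B \<subseteq> L2 a b" "u \<in> L2 a b"
  shows "\<exists>c. \<forall>g\<in>B. l2_inner a b (\<lambda>x. u x - (\<Sum>h\<in>B. c h * h x)) g = 0"
  using assms
proof (induction B arbitrary: u rule: finite_induct)
  case (insert g B)
  have B: "h \<in> L2 a b" if "h \<in> B" for h using that insert.prems by auto
  have g: "g \<in> L2 a b" using insert.prems by auto
  have S: "(\<lambda>x. \<Sum>h\<in>B. c h * h x) \<in> L2 a b" for c
    by (intro L2_sum L2_cmult B)
  obtain c where c: "\<forall>h\<in>B. l2_inner a b (\<lambda>x. u x - (\<Sum>h\<in>B. c h * h x)) h = 0"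
    using insert.IH[of u] insert.prems by auto
  obtain d where d: "\<forall>h\<in>B. l2_inner a b (\<lambda>x. g x - (\<Sum>h\<in>B. d h * h x)) h = 0"
    using insert.IH[of g] insert.prems by auto
  define r where "r x = u x - (\<Sum>h\<in>B. c h * h x)" for x
  define e where "e x = g x - (\<Sum>h\<in>B. d h * h x)" for x
  have r: "r \<in> L2 a b" unfolding r_def by (intro L2_diff S insert.prems)
  have e: "e \<in> L2 a b" unfolding e_def by (intro L2_diff S g)
  \<comment> \<open>If g depends on B almost everywhere, then e is null and division by zero makes
    \<alpha> = 0; orthogonality to e is then automatic.\<close>
  define \<alpha> where "\<alpha> = l2_inner a b r e / l2_inner a b e e"
  define r' where "r' x = r x - \<alpha> * e x" for x
  have r': "r' \<in> L2 a b" unfolding r'_def by (intro L2_diff L2_cmult r e)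
  have inner_r': "l2_inner a b r' v = l2_inner a b r v - \<alpha> * l2_inner a b e v" if "v \<in> L2 a b" for v
    unfolding r'_def l2_inner_diff_left[OF r L2_cmult[OF e] that] l2_inner_cmult_left ..
  have oB: "l2_inner a b r' h = 0" if "h \<in> B" for h
  proof -
    have "l2_inner a b r h = 0"
      using bspec[OF c that] unfolding r_def[abs_def] .
    moreover have "l2_inner a b e h = 0"
      using bspec[OF d that] unfolding e_def[abs_def] .
    ultimately show ?thesis unfolding inner_r'[OF B[OF that]] by simp
  qed
  have oe: "l2_inner a b r' e = 0"
  proof (cases "l2_inner a b e e = 0")
    case True
    have "l2_inner a b r e = 0"
      by (rule l2_inner_zero_right_ae[OF r e l2_inner_eq_0_imp_ae_eq_0[OF e True]])
    then show ?thesis unfolding inner_r'[OF e] True by simp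
  qed (simp add: inner_r'[OF e] \<alpha>_def)
  have "(\<lambda>x. e x + (\<Sum>h\<in>B. d h * h x)) = g" by (simp add: e_def)
  then have "l2_inner a b r' g = l2_inner a b (\<lambda>x. e x + (\<Sum>h\<in>B. d h * h x)) r'"
    by (subst l2_inner_commute) simp
  also have "\<dots> = l2_inner a b r' e + l2_inner a b r' (\<lambda>x. \<Sum>h\<in>B. d h * h x)"
    unfolding l2_inner_add_left[OF e S r'] by (simp only: l2_inner_commute[of a b _ r'])
  also have "l2_inner a b r' (\<lambda>x. \<Sum>h\<in>B. d h * h x) = (\<Sum>h\<in>B. d h * l2_inner a b r' h)"
    by (rule l2_inner_sum_right[where g="\<lambda>h. h", OF r' B])
  also have "l2_inner a b r' e + \<dots> = 0"
    using oe oB by simp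
  finally have og: "l2_inner a b r' g = 0" .
  \<comment> \<open>The coefficients of (\<Sum> c h) + \<alpha> (g - \<Sum> d h), collected by basis
    vector.\<close>
  define c' where "c' h = (if h = g then \<alpha> else c h - \<alpha> * d h)" for h
  have "(\<Sum>h\<in>B. c' h * h x) = (\<Sum>h\<in>B. c h * h x) - \<alpha> * (\<Sum>h\<in>B. d h * h x)" for x
  proof -
    have "(\<Sum>h\<in>B. c' h * h x) = (\<Sum>h\<in>B. c h * h x - \<alpha> * (d h * h x))"
      by (rule sum.cong) (use insert.hyps in \<open>auto simp: c'_def algebra_simps\<close>)
    then show ?thesis by (simp add: sum_subtractf sum_distrib_left)
  qed
  then have "r' = (\<lambda>x. u x - (\<Sum>h\<in>insert g B. c' h * h x))"
    using insert.hyps by (auto simp: r'_def r_def e_def c'_def algebra_simps)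
  then show ?case using oB og by (intro exI[of _ c']) auto
qed auto

lemma
  assumes "l2_subspace a b V"
  shows l2_subspace_L2: "V \<subseteq> L2 a b"
    and l2_subspace_ae: "f \<in> V \<Longrightarrow> g \<in> L2 a b \<Longrightarrow> ae_eq a b f g \<Longrightarrow> g \<in> V"
    and l2_subspace_zero: "(\<lambda>x. 0) \<in> V"
    and l2_subspace_add: "f \<in> V \<Longrightarrow> g \<in> V \<Longrightarrow> (\<lambda>x. f x + g x) \<in> V"
    and l2_subspace_cmult: "f \<in> V \<Longrightarrow> (\<lambda>x. c * f x) \<in> V"
  using assms unfolding l2_subspace_def by (blast, blast, blast, blast, blast)

lemma l2_subspace_sum:
  assumes "l2_subspace a b V" "B \<subseteq> V"
  shows "(\<lambda>x. \<Sum>g\<in>B. c g * g x) \<in> V"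
  using assms(2)
proof (induction B rule: infinite_finite_induct)
  case (insert g B)
  then have "(\<lambda>x. c g * g x + (\<Sum>g\<in>B. c g * g x)) \<in> V"
    by (intro l2_subspace_add[OF assms(1)] l2_subspace_cmult[OF assms(1)]) auto
  then show ?case using insert.hyps by simp
qed (simp_all add: l2_subspace_zero[OF assms(1)])

lemma l2_proj:
  assumes V: "l2_subspace a b V" and "l2_finite_dim a b V" and u: "u \<in> L2 a b"
  shows l2_proj_in: "l2_proj a b V u \<in> V"
    and l2_proj_orthogonal: "v \<in> V \<Longrightarrow> l2_inner a b (\<lambda>x. u x - l2_proj a b V u x) v = 0"
proof -
  obtain B where B: "finite B" "B \<subseteq> V" and span: "\<forall>f\<in>V. \<exists>c. ae_eq a b f (\<lambda>x. \<Sum>g\<in>B. c g * g x)"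
    using assms(2) unfolding l2_finite_dim_def by blast
  have VL: "V \<subseteq> L2 a b" by (rule l2_subspace_L2[OF V])
  obtain c where c: "\<forall>g\<in>B. l2_inner a b (\<lambda>x. u x - (\<Sum>h\<in>B. c h * h x)) g = 0"
    using exists_orthogonal_projection[OF B(1) _ u] B(2) VL by blast
  let ?p = "\<lambda>x. \<Sum>h\<in>B. c h * h x"
  have p: "?p \<in> V" by (rule l2_subspace_sum[OF V B(2)])
  have r: "(\<lambda>x. u x - ?p x) \<in> L2 a b" using p VL by (intro L2_diff u) auto
  \<comment> \<open>Orthogonality to the finite set \<open>B\<close> extends to V by expanding v
    almost everywhere in \<open>B\<close>.\<close>
  have "l2_inner a b (\<lambda>x. u x - ?p x) v = 0" if v: "v \<in> V" for v
  proof -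
    obtain d where d: "ae_eq a b v (\<lambda>x. \<Sum>g\<in>B. d g * g x)" using bspec[OF span v] by (rule exE)
    have "l2_inner a b (\<lambda>x. u x - ?p x) v = l2_inner a b (\<lambda>x. u x - ?p x) (\<lambda>x. \<Sum>g\<in>B. d g * g x)"
      by (rule l2_inner_cong[OF r r _ _ ae_eq_refl d])
        (use VL v l2_subspace_sum[OF V B(2)] in auto)
    also have "\<dots> = (\<Sum>g\<in>B. d g * l2_inner a b (\<lambda>x. u x - ?p x) g)"
      by (rule l2_inner_sum_right[where g="\<lambda>g. g", OF r]) (use VL B(2) in auto)
    also have "\<dots> = 0" using c by simp
    finally show ?thesis .
  qed
  with p have "?p \<in> V \<and> (\<forall>v\<in>V. l2_inner a b (\<lambda>x. u x - ?p x) v = 0)" by blast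
  then have "l2_proj a b V u \<in> V \<and> (\<forall>v\<in>V. l2_inner a b (\<lambda>x. u x - l2_proj a b V u x) v = 0)"
    unfolding l2_proj_def
    by (rule someI[where P = "\<lambda>p. p \<in> V \<and> (\<forall>v\<in>V. l2_inner a b (\<lambda>x. u x - p x) v = 0)"])
  then show "l2_proj a b V u \<in> V"
    and "v \<in> V \<Longrightarrow> l2_inner a b (\<lambda>x. u x - l2_proj a b V u x) v = 0" by auto
qed

text \<open>\<open>l2_finite_dim\<close> attaches coefficients to functions, not to indices. Where
  \<open>h\<close> is not injective, the coefficients of coinciding members have to be
  added.\<close>

lemma sum_coeff_image:
  fixes c :: "'i \<Rightarrow> real" and h :: "'i \<Rightarrow> 'a \<Rightarrow> real"
  assumes "finite I"
  shows "(\<Sum>i\<in>I. c i * h i x) = (\<Sum>g\<in>h ` I. (\<Sum>i\<in>{i\<in>I. h i = g}. c i) * g x)"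
proof -
  have "(\<Sum>i\<in>I. c i * h i x) = (\<Sum>g\<in>h ` I. \<Sum>i\<in>{i\<in>I. h i = g}. c i * h i x)"
    by (rule sum.image_gen[OF assms])
  also have "\<dots> = (\<Sum>g\<in>h ` I. (\<Sum>i\<in>{i\<in>I. h i = g}. c i) * g x)"
    by (intro sum.cong refl) (simp add: sum_distrib_right)
  finally show ?thesis .
qed

lemma polys_0_iff: "f \<in> polys a b 0 \<longleftrightarrow> f \<in> L2 a b \<and> (\<exists>c. ae_eq a b f (\<lambda>x. c))"
proof
  assume "f \<in> polys a b 0"
  then obtain p where p: "f \<in> L2 a b" "degree p = 0" "ae_eq a b f (poly p)"
    unfolding polys_def by auto
  obtain c where "p = [:c:]" using p(2) by (rule degree_eq_zeroE)
  then have "poly p = (\<lambda>x. c)" by auto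
  with p show "f \<in> L2 a b \<and> (\<exists>c. ae_eq a b f (\<lambda>x. c))" by auto
next
  assume "f \<in> L2 a b \<and> (\<exists>c. ae_eq a b f (\<lambda>x. c))"
  then obtain c where c: "f \<in> L2 a b" "ae_eq a b f (\<lambda>x. c)" by (elim conjE exE)
  have "poly [:c:] = (\<lambda>x. c)" by auto
  with c have "ae_eq a b f (poly [:c:])" by simp
  then show "f \<in> polys a b 0"
    unfolding polys_def using c(1) by (intro CollectI conjI exI[of _ "[:c:]"]) auto
qed

text \<open>The normal form in which members of \<open>Zspace\<close> at a successor level are
  handled.\<close>

lemma l2_sum_polys_0_int_op_iff:
  assumes "V \<subseteq> L2 a b"
  shows "f \<in> l2_sum a b (polys a b 0) (int_op a ` V) \<longleftrightarrow>
    f \<in> L2 a b \<and> (\<exists>c. \<exists>z\<in>V. ae_eq a b f (\<lambda>x. c + int_op a z x))"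
proof
  assume "f \<in> l2_sum a b (polys a b 0) (int_op a ` V)"
  then obtain g z where "f \<in> L2 a b" "g \<in> polys a b 0" "z \<in> V" and f: "ae_eq a b f (\<lambda>x. g x + int_op a z x)"
    unfolding l2_sum_def by auto
  moreover from this obtain c where "ae_eq a b g (\<lambda>x. c)" by (auto simp: polys_0_iff)
  from ae_eq_trans[OF f ae_eq_add[OF this ae_eq_refl]]
  have "ae_eq a b f (\<lambda>x. c + int_op a z x)" .
  ultimately show "f \<in> L2 a b \<and> (\<exists>c. \<exists>z\<in>V. ae_eq a b f (\<lambda>x. c + int_op a z x))" by blast
next
  assume "f \<in> L2 a b \<and> (\<exists>c. \<exists>z\<in>V. ae_eq a b f (\<lambda>x. c + int_op a z x))"
  then obtain c z where "f \<in> L2 a b" "z \<in> V" "ae_eq a b f (\<lambda>x. c + int_op a z x)" by blast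
  moreover have "(\<lambda>x. c) \<in> polys a b 0" unfolding polys_0_iff
    by (intro conjI L2_const exI[of _ c] ae_eq_refl)
  ultimately show "f \<in> l2_sum a b (polys a b 0) (int_op a ` V)"
    unfolding l2_sum_def
    by (intro CollectI conjI bexI[of _ "\<lambda>x. c"] bexI[of _ "int_op a z"] imageI)
qed

lemma l2_subspace_polys_0_plus_int_op:
  assumes V: "l2_subspace a b V"
  shows "l2_subspace a b (l2_sum a b (polys a b 0) (int_op a ` V))"
proof -
  let ?W = "l2_sum a b (polys a b 0) (int_op a ` V)"
  have VL: "V \<subseteq> L2 a b" by (rule l2_subspace_L2[OF V])
  note iff = l2_sum_polys_0_int_op_iff[OF VL]
  have ae: "g \<in> ?W" if "f \<in> ?W" "g \<in> L2 a b" "ae_eq a b f g" for f g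
    using that ae_eq_trans[OF ae_eq_sym[OF that(3)]] unfolding iff by blast
  have add: "(\<lambda>x. f x + g x) \<in> ?W" if f: "f \<in> ?W" and g: "g \<in> ?W" for f g
  proof -
    obtain c z where c: "f \<in> L2 a b" "z \<in> V" "ae_eq a b f (\<lambda>x. c + int_op a z x)"
      using f unfolding iff by blast
    obtain d w where d: "g \<in> L2 a b" "w \<in> V" "ae_eq a b g (\<lambda>x. d + int_op a w x)"
      using g unfolding iff by blast
    have zw: "(\<lambda>x. z x + w x) \<in> V" by (rule l2_subspace_add[OF V c(2) d(2)])
    have "z \<in> L2 a b" "w \<in> L2 a b" using c d VL by auto
    then have "ae_eq a b (\<lambda>x. (c + int_op a z x) + (d + int_op a w x))
        (\<lambda>x. (c + d) + int_op a (\<lambda>x. z x + w x) x)"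
      by (intro ae_eq_I) (simp add: int_op_add)
    from ae_eq_trans[OF ae_eq_add[OF c(3) d(3)] this] show ?thesis
      unfolding iff using zw L2_add[OF c(1) d(1)] by blast
  qed
  have cmult: "(\<lambda>x. k * f x) \<in> ?W" if f: "f \<in> ?W" for f k
  proof -
    obtain c z where c: "f \<in> L2 a b" "z \<in> V" "ae_eq a b f (\<lambda>x. c + int_op a z x)"
      using f unfolding iff by blast
    have z: "(\<lambda>x. k * z x) \<in> V" by (rule l2_subspace_cmult[OF V c(2)])
    have "(\<lambda>x. k * (c + int_op a z x)) = (\<lambda>x. k * c + int_op a (\<lambda>x. k * z x) x)"
      by (simp add: int_op_cmult distrib_left)
    with ae_eq_cmult[OF c(3), of k]
    have "ae_eq a b (\<lambda>x. k * f x) (\<lambda>x. k * c + int_op a (\<lambda>x. k * z x) x)" by simp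
    then show ?thesis
      unfolding iff using z L2_cmult[OF c(1)] by blast
  qed
  have "(\<lambda>x. 0) \<in> V" by (rule l2_subspace_zero[OF V])
  moreover have "(\<lambda>x. 0) = (\<lambda>x. 0 + int_op a (\<lambda>x. 0) x)" by (simp add: int_op_def)
  ultimately have "(\<lambda>x. 0) \<in> ?W" unfolding iff by (metis L2_const ae_eq_refl)
  with ae add cmult show ?thesis unfolding l2_subspace_def by (auto simp: l2_sum_def)
qed

lemma l2_finite_dim_polys_0_plus_int_op:
  assumes V: "l2_subspace a b V" and "l2_finite_dim a b V"
  shows "l2_finite_dim a b (l2_sum a b (polys a b 0) (int_op a ` V))"
proof -
  let ?W = "l2_sum a b (polys a b 0) (int_op a ` V)"
  obtain B where B: "finite B" "B \<subseteq> V" and span: "\<forall>f\<in>V. \<exists>c. ae_eq a b f (\<lambda>x. \<Sum>g\<in>B. c g * g x)"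
    using assms(2) unfolding l2_finite_dim_def by blast
  have VL: "V \<subseteq> L2 a b" by (rule l2_subspace_L2[OF V])
  have V0: "(\<lambda>x. 0) \<in> V" by (rule l2_subspace_zero[OF V])
  have BL: "g \<in> L2 a b" if "g \<in> B" for g using B VL that by auto
  note iff = l2_sum_polys_0_int_op_iff[OF VL]
  \<comment> \<open>The spanning family is the constant 1, indexed by \<open>None\<close>, with the
    images under K of the old one. Indexing tolerates coincidences among these functions.\<close>
  define h where "h i = (case i of None \<Rightarrow> \<lambda>x. 1 | Some g \<Rightarrow> int_op a g)" for i
  let ?I = "insert None (Some ` B)"
  have hW: "h i \<in> ?W" if i: "i \<in> ?I" for i
  proof (cases i)
    case None
    have "h i = (\<lambda>x. 1 + int_op a (\<lambda>x. 0) x)" by (simp add: None h_def int_op_def)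
    then show ?thesis unfolding iff using V0 L2_const by (metis None ae_eq_refl h_def option.simps(4))
  next
    case (Some g)
    have "h i = (\<lambda>x. 0 + int_op a g x)" by (simp add: Some h_def)
    moreover have "g \<in> B" using i Some by auto
    ultimately show ?thesis unfolding iff using B(2) L2_int_op[OF BL]
      by (auto intro!: exI[of _ 0] bexI[of _ g])
  qed
  have "\<exists>d. ae_eq a b f (\<lambda>x. \<Sum>g\<in>h ` ?I. d g * g x)" if f: "f \<in> ?W" for f
  proof -
    obtain c z where c: "f \<in> L2 a b" "z \<in> V" "ae_eq a b f (\<lambda>x. c + int_op a z x)"
      using f unfolding iff by blast
    obtain e where e: "ae_eq a b z (\<lambda>x. \<Sum>g\<in>B. e g * g x)" using bspec[OF span c(2)] by (rule exE)
    define k where "k i = (case i of None \<Rightarrow> c | Some g \<Rightarrow> e g)" for i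
    have "ae_eq a b (int_op a z) (int_op a (\<lambda>x. \<Sum>g\<in>B. e g * g x))"
      by (rule ae_eq_int_op[OF _ _ e]) (use c(2) VL l2_subspace_sum[OF V B(2)] in auto)
    moreover have "ae_eq a b (int_op a (\<lambda>x. \<Sum>g\<in>B. e g * g x)) (\<lambda>x. \<Sum>g\<in>B. e g * int_op a g x)"
      by (rule ae_eq_I) (simp add: int_op_sum[OF BL])
    ultimately have "ae_eq a b (int_op a z) (\<lambda>x. \<Sum>g\<in>B. e g * int_op a g x)"
      by (rule ae_eq_trans)
    from ae_eq_trans[OF c(3) ae_eq_add[OF ae_eq_refl this]]
    have "ae_eq a b f (\<lambda>x. c + (\<Sum>g\<in>B. e g * int_op a g x))" .
    also have "(\<lambda>x. c + (\<Sum>g\<in>B. e g * int_op a g x)) = (\<lambda>x. \<Sum>i\<in>?I. k i * h i x)"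
      using B(1) by (simp add: k_def h_def sum.reindex image_iff)
    also have "\<dots> = (\<lambda>x. \<Sum>g\<in>h ` ?I. (\<Sum>i\<in>{i\<in>?I. h i = g}. k i) * g x)"
      by (rule ext, rule sum_coeff_image) (use B(1) in simp)
    finally show ?thesis
      by (rule exI[of _ "\<lambda>g. \<Sum>i\<in>{i\<in>?I. h i = g}. k i"])
  qed
  then show ?thesis unfolding l2_finite_dim_def
    by (intro exI[of _ "h ` ?I"]) (use hW B(1) in auto)
qed

lemma Zspace_subspace:
  assumes "l2_subspace a b Z0" shows "l2_subspace a b (Zspace a b Z0 t)"
  by (induction t) (use assms l2_subspace_polys_0_plus_int_op in auto)

lemma Zspace_finite_dim:
  assumes "l2_subspace a b Z0" "l2_finite_dim a b Z0" shows "l2_finite_dim a b (Zspace a b Z0 t)"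
  by (induction t)
    (use assms l2_finite_dim_polys_0_plus_int_op Zspace_subspace in auto)

lemma Zspace_L2: "l2_subspace a b Z0 \<Longrightarrow> Zspace a b Z0 t \<subseteq> L2 a b"
  by (rule l2_subspace_L2[OF Zspace_subspace])

section \<open>Exactness at the right end point\<close>

lemma exists_poly_antiderivative:
  fixes p :: "real poly"
  obtains P where "pderiv P = p" "degree P \<le> Suc (degree p)" "poly P x0 = 0"
proof -
  define P where "P = (\<Sum>i\<le>degree p. monom (coeff p i / real (Suc i)) (Suc i))"
  have "pderiv P = p"
    by (rule poly_eqI)
      (auto simp: coeff_pderiv P_def coeff_sum coeff_monom coeff_eq_0 simp del: of_nat_Suc)
  moreover have dP: "degree P \<le> Suc (degree p)"
    unfolding P_def by (rule degree_sum_le) (auto intro: order_trans[OF degree_monom_le])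
  moreover have "degree (P - [:poly P x0:]) \<le> Suc (degree p)"
    by (rule degree_diff_le[OF dP]) simp
  ultimately show ?thesis
    by (intro that[of "P - [:poly P x0:]"]) (simp_all add: pderiv_diff pderiv_pCons)
qed

lemma poly_eq_int_op_pderiv:
  assumes "x \<in> {a..b}"
  shows "poly P x = poly P a + int_op a (poly (pderiv P)) x"
proof -
  have "(poly (pderiv P) has_integral (poly P x - poly P a)) {a..x}"
    by (rule fundamental_theorem_of_calculus)
      (use assms in \<open>auto intro: DERIV_subset[OF poly_DERIV] simp flip: has_real_derivative_iff_has_vector_derivative\<close>)
  then have "integral {a..x} (poly (pderiv P)) = poly P x - poly P a"
    by (rule integral_unique)
  then show ?thesis
    using assms int_op_eq_integral[OF L2_integrable[OF L2_poly], of x b a "pderiv P"] by simp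
qed

text \<open>An antiderivative P of p lies one level up, so P = c + K z with z in the lower space.
  Both p and z are weak derivatives of P, hence p = z almost everywhere.\<close>

lemma polys_subset_Zspace_Suc_D:
  assumes "a < b" "l2_subspace a b Z0" "polys a b (Suc k) \<subseteq> Zspace a b Z0 (Suc t)"
  shows "polys a b k \<subseteq> Zspace a b Z0 t"
proof
  fix f assume "f \<in> polys a b k"
  then obtain p where f: "f \<in> L2 a b" and p: "degree p \<le> k" "ae_eq a b f (poly p)"
    unfolding polys_def by auto
  obtain P where P: "pderiv P = p" "degree P \<le> Suc (degree p)"
    by (rule exists_poly_antiderivative)
  have ZL: "Zspace a b Z0 t \<subseteq> L2 a b" by (rule Zspace_L2[OF assms(2)])
  have "degree P \<le> Suc k" using P(2) p(1) by simp
  then have "poly P \<in> polys a b (Suc k)"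
    unfolding polys_def by (intro CollectI conjI L2_poly exI[of _ P] ae_eq_refl)
  then have "poly P \<in> Zspace a b Z0 (Suc t)" using assms(3) by auto
  then have "\<exists>c. \<exists>z\<in>Zspace a b Z0 t. ae_eq a b (poly P) (\<lambda>x. c + int_op a z x)"
    unfolding Zspace.simps l2_sum_polys_0_int_op_iff[OF ZL] by (rule conjunct2)
  then obtain c z where z: "z \<in> Zspace a b Z0 t" and Pz: "ae_eq a b (poly P) (\<lambda>x. c + int_op a z x)"
    by (elim exE bexE)
  have zL: "z \<in> L2 a b" using z ZL by auto
  have "has_weak_deriv a b 1 (poly P) z"
    by (rule has_weak_deriv_cong[OF has_weak_deriv_int_op[OF zL] L2_poly zL ae_eq_sym[OF Pz] ae_eq_refl])
  moreover have "has_weak_deriv a b 1 (poly P) (poly p)"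
  proof (rule has_weak_deriv_cong[OF has_weak_deriv_int_op[OF L2_poly] L2_poly L2_poly _ ae_eq_refl])
    show "ae_eq a b (\<lambda>x. poly P a + int_op a (poly p) x) (poly P)"
    proof (rule ae_eq_sym, rule ae_eq_I)
      fix x assume "a < x" "x < b"
      then have "x \<in> {a..b}" by simp
      then show "poly P x = poly P a + int_op a (poly p) x"
        unfolding P(1)[symmetric] by (rule poly_eq_int_op_pderiv)
    qed
  qed
  ultimately have "ae_eq a b z (poly p)" by (rule has_weak_deriv_unique[OF \<open>a < b\<close>])
  then have "ae_eq a b z f" by (rule ae_eq_trans[OF _ ae_eq_sym[OF p(2)]])
  then show "f \<in> Zspace a b Z0 t"
    by (rule l2_subspace_ae[OF Zspace_subspace[OF assms(2)] z f])
qed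

lemma polys_subset_Zspace_add_D:
  assumes "a < b" "l2_subspace a b Z0" "polys a b (k + m) \<subseteq> Zspace a b Z0 (t + m)"
  shows "polys a b k \<subseteq> Zspace a b Z0 t"
  using assms(3) by (induction m) (use polys_subset_Zspace_Suc_D[OF assms(1,2)] in auto)

section \<open>Sobolev spaces and point values\<close>

lemma sobolev_H_L2: "u \<in> sobolev_H a b q \<Longrightarrow> u \<in> L2 a b"
  by (simp add: sobolev_H_def)

lemma sobolev_H_has_weak_deriv:
  assumes "u \<in> sobolev_H a b q" "k \<le> q"
  shows "has_weak_deriv a b k u (weak_deriv a b k u)"
proof (cases "k = 0")
  case True
  then show ?thesis
    using has_weak_deriv_weak_deriv[OF has_weak_deriv_0[OF sobolev_H_L2[OF assms(1)]]] by simp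
next
  case False
  then have "k \<in> {1..q}" using assms(2) by simp
  then obtain v where "has_weak_deriv a b k u v" using assms(1) unfolding sobolev_H_def by blast
  then show ?thesis by (rule has_weak_deriv_weak_deriv)
qed

lemma sobolev_H_weak_deriv:
  assumes "u \<in> sobolev_H a b (Suc q)"
  shows "weak_deriv a b 1 u \<in> sobolev_H a b q"
proof -
  have 1: "has_weak_deriv a b 1 u (weak_deriv a b 1 u)"
    by (rule sobolev_H_has_weak_deriv[OF assms]) simp
  have "has_weak_deriv a b k (weak_deriv a b 1 u) (weak_deriv a b (Suc k) u)" if "k \<in> {1..q}" for k
    by (rule has_weak_deriv_Suc_D[OF 1 sobolev_H_has_weak_deriv[OF assms]]) (use that in simp)
  then show ?thesis
    using 1 unfolding sobolev_H_def has_weak_deriv_def by blast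
qed

lemma sobolev_H_Suc_I:
  assumes "has_weak_deriv a b 1 u v" "v \<in> sobolev_H a b q"
  shows "u \<in> sobolev_H a b (Suc q)"
proof -
  have "\<exists>w\<in>L2 a b. has_weak_deriv a b k u w" if range: "k \<in> {1..Suc q}" for k
  proof -
    obtain k' where k: "k = Suc k'" "k' \<le> q" using range by (cases k) auto
    have "has_weak_deriv a b k u (weak_deriv a b k' v)"
      unfolding k(1) by (rule has_weak_deriv_Suc[OF assms(1) sobolev_H_has_weak_deriv[OF assms(2) k(2)]])
    moreover from this have "weak_deriv a b k' v \<in> L2 a b" by (simp add: has_weak_deriv_def)
    ultimately show ?thesis by (rule bexI)
  qed
  then show ?thesis using assms(1) by (simp add: sobolev_H_def has_weak_deriv_def)
qed

text \<open>The two sides involve separately chosen derivatives, but both are weak derivatives of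
  order k+1 of u and so have the same continuous representative.\<close>

lemma point_val_Suc:
  assumes "a < b" "has_weak_deriv a b 1 u v" "v \<in> sobolev_H a b k"
  shows "point_val a b (Suc k) u = point_val a b k v"
proof -
  have "has_weak_deriv a b (Suc k) u (weak_deriv a b k v)"
    by (rule has_weak_deriv_Suc[OF assms(2) sobolev_H_has_weak_deriv[OF assms(3) order.refl]])
  from cont_rep_cong[OF ae_eq_weak_deriv[OF assms(1) this]] show ?thesis
    by (simp add: point_val_def fun_eq_iff)
qed

text \<open>Even at order 0 \<open>point_val\<close> passes through \<open>weak_deriv\<close>, whose
  chosen value is only almost everywhere equal to u.\<close>

lemma point_val_0_int_op:
  assumes "a < b" "v \<in> L2 a b" "u \<in> L2 a b" "ae_eq a b u (\<lambda>x. c + int_op a v x)" "x \<in> {a..b}"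
  shows "point_val a b 0 u x = c + int_op a v x"
  unfolding point_val_def
proof (rule cont_rep_eq[OF assms(1) _ _ assms(5)])
  show "continuous_on {a..b} (\<lambda>x. c + int_op a v x)"
    by (intro continuous_intros continuous_on_int_op L2_integrable assms)
  show "ae_eq a b (weak_deriv a b 0 u) (\<lambda>x. c + int_op a v x)"
    by (rule ae_eq_trans[OF ae_eq_weak_deriv[OF assms(1) has_weak_deriv_0[OF assms(3)]] assms(4)])
qed

lemma sobolev_H_ae_eq_int_op:
  assumes "a < b" "u \<in> sobolev_H a b (Suc q)"
  shows "ae_eq a b u (\<lambda>x. point_val a b 0 u a + int_op a (weak_deriv a b 1 u) x)"
proof -
  have 1: "has_weak_deriv a b 1 u (weak_deriv a b 1 u)"
    by (rule sobolev_H_has_weak_deriv[OF assms(2)]) simp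
  obtain c where c: "ae_eq a b u (\<lambda>x. c + int_op a (weak_deriv a b 1 u) x)"
    by (rule weakly_differentiable_eq_int_op[OF assms(1) 1])
  \<comment> \<open>The unknown constant is identified at a, where K vanishes.\<close>
  have "point_val a b 0 u a = c"
    using point_val_0_int_op[OF assms(1) _ _ c, of a] 1 assms(1) by (simp add: has_weak_deriv_def)
  with c show ?thesis by simp
qed

lemma point_val_0_eq_int_op_weak_deriv:
  assumes "a < b" "u \<in> sobolev_H a b (Suc q)" "x \<in> {a..b}"
  shows "point_val a b 0 u x = point_val a b 0 u a + int_op a (weak_deriv a b 1 u) x"
  by (rule point_val_0_int_op[OF assms(1) sobolev_H_L2[OF sobolev_H_weak_deriv[OF assms(2)]]
        sobolev_H_L2[OF assms(2)] sobolev_H_ae_eq_int_op[OF assms(1,2)] assms(3)])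

section \<open>The projectors: regularity, orthogonality of the error, and values at b\<close>

context
  fixes a b :: real and Z0 :: "(real \<Rightarrow> real) set"
  assumes ab: "a < b" and Z0: "l2_subspace a b Z0" "l2_finite_dim a b Z0"
begin

text \<open>The base case is merely in L2; every recursion step integrates once and gains one
  derivative.\<close>

lemma Qproj_in_sobolev_H:
  assumes "u \<in> sobolev_H a b q"
  shows "Qproj a b Z0 q t u \<in> sobolev_H a b q"
  using assms
proof (induction q arbitrary: t u)
  case 0
  then have "l2_proj a b (Zspace a b Z0 t) u \<in> Zspace a b Z0 t"
    by (intro l2_proj_in Zspace_subspace Zspace_finite_dim Z0 sobolev_H_L2)
  then show ?case using Zspace_L2[OF Z0(1)] by (auto simp: sobolev_H_def)
next
  case (Suc q)
  let ?v = "Qproj a b Z0 q (t - 1) (weak_deriv a b 1 u)"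
  have v: "?v \<in> sobolev_H a b q" by (intro Suc.IH sobolev_H_weak_deriv Suc.prems)
  show ?case
    unfolding Qproj.simps by (rule sobolev_H_Suc_I[OF has_weak_deriv_int_op[OF sobolev_H_L2[OF v]] v])
qed

text \<open>Each unfolding replaces p by an antiderivative and lowers m and t together, so k + m and
  t - m are invariants of the induction. This is why the inclusion is stated through them: it is
  passed down unchanged and used only at m = 0.\<close>

lemma Qproj_orthogonal:
  assumes "m \<le> t" "polys a b (k + m) \<subseteq> Zspace a b Z0 (t - m)" "u \<in> sobolev_H a b m" "degree p \<le> k"
  shows "l2_inner a b (\<lambda>x. u x - Qproj a b Z0 m t u x) (poly p) = 0"
  using assms
proof (induction m arbitrary: t k u p)
  case 0
  have "poly p \<in> polys a b k"
    unfolding polys_def using 0(4) by (intro CollectI conjI L2_poly exI[of _ p] ae_eq_refl)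
  then show ?case
    unfolding Qproj.simps
    by (intro l2_proj_orthogonal Zspace_subspace Zspace_finite_dim Z0) (use 0 sobolev_H_L2 in auto)
next
  case (Suc m)
  obtain t' where t: "t = Suc t'" using Suc.prems(1) by (cases t) auto
  let ?u' = "weak_deriv a b 1 u"
  let ?v = "Qproj a b Z0 m t' ?u'"
  define e where "e x = ?u' x - ?v x" for x
  have u': "?u' \<in> sobolev_H a b m" by (rule sobolev_H_weak_deriv[OF Suc.prems(3)])
  have L: "?u' \<in> L2 a b" "?v \<in> L2 a b"
    by (rule sobolev_H_L2[OF u'], rule sobolev_H_L2[OF Qproj_in_sobolev_H[OF u']])
  have eL: "e \<in> L2 a b" unfolding e_def by (rule L2_diff[OF L])
  \<comment> \<open>Normalized at b, to remove the boundary term.\<close>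
  obtain G where G: "pderiv G = p" "degree G \<le> Suc (degree p)" "poly G b = 0"
    by (rule exists_poly_antiderivative)
  have "l2_inner a b e (poly G) = 0"
    unfolding e_def
  proof (rule Suc.IH[OF _ _ u', of _ "Suc k"])
    show "m \<le> t'" using Suc.prems(1) t by simp
    show "polys a b (Suc k + m) \<subseteq> Zspace a b Z0 (t' - m)" using Suc.prems(2) t by simp
    show "degree G \<le> Suc k" using G(2) Suc.prems(4) by simp
  qed
  moreover have "l2_inner a b (int_op a e) (poly p) = - l2_inner a b e (poly G)"
    unfolding l2_inner_def
  proof (rule integral_by_parts_int_op[where G = "poly G", OF L2_integrable[OF eL] _ _ G(3)])
    show "(poly G has_field_derivative poly p x) (at x within {a..b})" for x
      using DERIV_subset[OF poly_DERIV[of G x]] unfolding G(1) by simp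
  qed (intro continuous_intros)
  \<comment> \<open>The error is K e: the values u(a) in the expansion of u and in the recursion for
    Q cancel.\<close>
  moreover have "l2_inner a b (\<lambda>x. u x - Qproj a b Z0 (Suc m) t u x) (poly p) = l2_inner a b (int_op a e) (poly p)"
  proof (rule l2_inner_cong[OF L2_diff L2_int_op[OF eL] L2_poly L2_poly _ ae_eq_refl])
    show "u \<in> L2 a b" "Qproj a b Z0 (Suc m) t u \<in> L2 a b"
      by (rule sobolev_H_L2[OF Suc.prems(3)], rule sobolev_H_L2[OF Qproj_in_sobolev_H[OF Suc.prems(3)]])
    have "ae_eq a b (\<lambda>x. u x - Qproj a b Z0 (Suc m) t u x)
       (\<lambda>x. (point_val a b 0 u a + int_op a ?u' x) - (point_val a b 0 u a + int_op a ?v x))"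
      unfolding Qproj.simps t diff_Suc_1
      by (rule ae_eq_diff[OF sobolev_H_ae_eq_int_op[OF ab Suc.prems(3)] ae_eq_refl])
    moreover have "ae_eq a b (\<lambda>x. (point_val a b 0 u a + int_op a ?u' x) - (point_val a b 0 u a + int_op a ?v x))
        (int_op a e)"
      by (rule ae_eq_I) (simp add: e_def[abs_def] int_op_diff[OF L] del: One_nat_def)
    ultimately show "ae_eq a b (\<lambda>x. u x - Qproj a b Z0 (Suc m) t u x) (int_op a e)"
      by (rule ae_eq_trans)
  qed
  ultimately show ?case by simp
qed

lemma Qproj_Suc_has_weak_deriv:
  assumes "u \<in> sobolev_H a b (Suc q)"
  shows "has_weak_deriv a b 1 (Qproj a b Z0 (Suc q) (Suc t) u) (Qproj a b Z0 q t (weak_deriv a b 1 u))"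
  unfolding Qproj.simps diff_Suc_1
  by (intro has_weak_deriv_int_op sobolev_H_L2[OF Qproj_in_sobolev_H] sobolev_H_weak_deriv assms)

lemma point_val_0_Qproj:
  assumes "q \<le> t" "polys a b (Suc (2 * q)) \<subseteq> Zspace a b Z0 (Suc t)" "u \<in> sobolev_H a b (Suc q)"
  shows "point_val a b 0 (Qproj a b Z0 (Suc q) (Suc t) u) b = point_val a b 0 u b"
proof -
  let ?u' = "weak_deriv a b 1 u"
  let ?v = "Qproj a b Z0 q t ?u'"
  have u': "?u' \<in> sobolev_H a b q" by (rule sobolev_H_weak_deriv[OF assms(3)])
  have L: "?u' \<in> L2 a b" "?v \<in> L2 a b"
    by (rule sobolev_H_L2[OF u'], rule sobolev_H_L2[OF Qproj_in_sobolev_H[OF u']])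
  \<comment> \<open>Here 2q+1 = q + (q+1) and t+1 = (t-q) + (q+1): after q+1 differentiations the
    degree is q at level t-q, which is what \<open>Qproj_orthogonal\<close> demands for k = 0 and m
    = q.\<close>
  have "polys a b (q + Suc q) \<subseteq> Zspace a b Z0 ((t - q) + Suc q)"
    using assms(1,2) by (simp add: mult_2)
  then have "polys a b q \<subseteq> Zspace a b Z0 (t - q)"
    by (rule polys_subset_Zspace_add_D[OF ab Z0(1)])
  then have "l2_inner a b (\<lambda>x. ?u' x - ?v x) (poly 1) = 0"
    by (intro Qproj_orthogonal[where k = 0] assms(1) u') auto
  then have "int_op a (\<lambda>x. ?u' x - ?v x) b = 0"
    by (simp add: l2_inner_def int_op_def)
  then have eq: "int_op a ?u' b = int_op a ?v b"
    using int_op_diff[OF L order.refl] by simp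
  have "point_val a b 0 (Qproj a b Z0 (Suc q) (Suc t) u) b = point_val a b 0 u a + int_op a ?v b"
    unfolding Qproj.simps diff_Suc_1
    by (rule point_val_0_int_op[OF ab L(2) L2_add[OF L2_const L2_int_op[OF L(2)]] ae_eq_refl]) (use ab in simp)
  also have "\<dots> = point_val a b 0 u b"
    using point_val_0_eq_int_op_weak_deriv[OF ab assms(3), of b] ab eq by simp
  finally show ?thesis .
qed

lemma point_val_Qproj:
  assumes "l < q" "q \<le> t" "polys a b (2 * q - l - 1) \<subseteq> Zspace a b Z0 t" "u \<in> sobolev_H a b q"
  shows "point_val a b l (Qproj a b Z0 q t u) b = point_val a b l u b"
  using assms
proof (induction l arbitrary: q t u)
  case 0
  obtain q' t' where "q = Suc q'" "t = Suc t'" using 0 by (cases q; cases t) auto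
  with 0 show ?case by (auto intro!: point_val_0_Qproj simp del: Zspace.simps Qproj.simps)
next
  case (Suc l)
  obtain q' t' where qt: "q = Suc q'" "t = Suc t'" using Suc.prems(1,2) by (cases q; cases t) auto
  let ?u' = "weak_deriv a b 1 u"
  have u: "u \<in> sobolev_H a b (Suc q')" using Suc.prems(4) qt by simp
  have u': "?u' \<in> sobolev_H a b q'" by (rule sobolev_H_weak_deriv[OF u])
  have lq: "l < q'" "q' \<le> t'" using Suc.prems(1,2) qt by auto
  have mono: "v \<in> sobolev_H a b l" if "v \<in> sobolev_H a b q'" for v
    using that lq(1) by (auto simp: sobolev_H_def)
  \<comment> \<open>Lowering q and l by one lowers 2q-l-1 by one, which matches one differentiation
    of the inclusion. Since l < q', the natural-number subtraction does not truncate.\<close>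
  have "2 * q - Suc l - 1 = Suc (2 * q' - l - 1)" using lq qt by simp
  then have "polys a b (Suc (2 * q' - l - 1)) \<subseteq> Zspace a b Z0 (Suc t')"
    using Suc.prems(3) qt by simp
  then have polys: "polys a b (2 * q' - l - 1) \<subseteq> Zspace a b Z0 t'"
    by (rule polys_subset_Zspace_Suc_D[OF ab Z0(1)])
  have "point_val a b (Suc l) (Qproj a b Z0 q t u) b = point_val a b l (Qproj a b Z0 q' t' ?u') b"
    unfolding qt
    by (subst point_val_Suc[OF ab Qproj_Suc_has_weak_deriv[OF u] mono[OF Qproj_in_sobolev_H[OF u']]]) simp
  also have "\<dots> = point_val a b l ?u' b"
    by (rule Suc.IH[OF lq polys u'])
  also have "\<dots> = point_val a b (Suc l) u b"
    by (subst point_val_Suc[OF ab sobolev_H_has_weak_deriv[OF u] mono[OF u']]) simp_all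
  finally show ?case .
qed

end

theorem lemma2:
  fixes a b :: real and Z0 :: "(real \<Rightarrow> real) set" and q t l :: nat
  assumes "a < b"
    and "l2_subspace a b Z0" and "l2_finite_dim a b Z0"
    and "polys a b 0 \<subseteq> Z0"
    and "\<And>s. s \<ge> 1 \<Longrightarrow>
           l2_sum a b (polys a b 0) (int_op a ` Zspace a b Z0 (s - 1)) =
           l2_sum a b (polys a b 0) (int_op_adj b ` Zspace a b Z0 (s - 1))"
    and "1 \<le> q" and "q \<le> t"
    and "l \<in> {0..q - 1}"
    and "polys a b (2 * q - l - 1) \<subseteq> Zspace a b Z0 t"
  shows "\<forall>u \<in> sobolev_H a b q.
           point_val a b l (Qproj a b Z0 q t u) b = point_val a b l u b"
proof
  fix u assume "u \<in> sobolev_H a b q"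
  \<comment> \<open>Relies on 1 \<le> q: for q = 0 the truncated q - 1 would still admit l =
    0.\<close>
  moreover have "l < q" using assms(6,8) by auto
  ultimately show "point_val a b l (Qproj a b Z0 q t u) b = point_val a b l u b"
    using point_val_Qproj[OF assms(1-3)] assms(7,9) by blast
qed

end
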